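(* Let $1\le h<n$ be integers, let $A\in\mathbb{R}^{n\times n}$ be the shift matrix, let $X$ be a random vector in $S^{n-1}$, and let $\mathcal{G}$ be one of $SO(n)$, $\mathbb{S}(n)$, $\mathbb{B}(n)$; in the case $\mathcal{G}=\mathbb{S}(n)$ assume in addition that $\sum_{i=1}^n X_i=0$. Let $\hat{T}_h(M)=(MX)^{\mathrm T}A^h(MX)$ for $M\in\mathcal{G}$. Let $M$ be a random element of $\mathcal{G}$, independent of $X$, distributed with respect to normalized Haar measure. Then for each $t>0$, $$\mathbb{P}\left(\hat{T}_h(M)\ge t\mid X\right)\le\begin{cases}\exp\{-(n-2)t^2/64\}, & \text{if }\mathcal{G}=SO(n),\\ \exp\{-t^2/16\}, & \text{if }\mathcal{G}=\mathbb{S}(n),\\ \exp\{-t^2/64\}, & \text{if }\mathcal{G}=\mathbb{B}(n).\end{cases}$$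
   Context: $S^{n-1}$ is the Euclidean unit sphere in $\mathbb{R}^n$. The shift matrix $A$ has entries $A_{i,i+1}=1$ for $1\le i\le n-1$ and all other entries $0$, so that $x^{\mathrm T}A^hx=\sum_{i=1}^{n-h}x_ix_{i+h}$. $SO(n)$ is the special orthogonal group; $\mathbb{S}(n)$ is the symmetric group, acting on $\mathbb{R}^n$ by permutation matrices, $(\pi x)_i=x_{\pi(i)}$; $\mathbb{B}(n)=\{-1,1\}^n$ acts on $\mathbb{R}^n$ by diagonal matrices with diagonal entries $\pm1$. Normalized Haar measure on the finite groups $\mathbb{S}(n)$ and $\mathbb{B}(n)$ is the uniform distribution. *)

theory Defs
  imports "HOL-Probability.Probability"
begin

text \<open>Coordinates are indexed by a finite linearly ordered type; \<open>position i\<close> is the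
  1-based place of \<open>i\<close>, an order isomorphism onto \<open>{1..CARD('n)}\<close>.\<close>

definition position :: "'n::{finite,linorder} \<Rightarrow> nat" where
  "position i = card {..i}"

definition shift_matrix :: "real^'n::{finite,linorder}^'n::{finite,linorder}" where
  "shift_matrix = (\<chi> i j. if position j = position i + 1 then 1 else 0)"

text \<open>The library's \<open>*\<close> and \<open>^\<close> on \<open>real^'n^'n\<close> are not those of the matrix ring, hence a separate
  power for \<open>**\<close>.\<close>

primrec matrix_pow :: "real^'n^'n \<Rightarrow> nat \<Rightarrow> real^'n^'n" where
  "matrix_pow A 0 = mat 1"
| "matrix_pow A (Suc k) = A ** matrix_pow A k"

definition SO_group :: "(real^'n^'n) set" where
  "SO_group = {Q. rotation_matrix Q}"

definition perm_matrix :: "('n \<Rightarrow> 'n) \<Rightarrow> real^'n^'n" where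
  "perm_matrix p = (\<chi> i j. if j = p i then 1 else 0)"

definition perm_group :: "(real^'n^'n) set" where
  "perm_group = {perm_matrix p | p. p permutes UNIV}"

definition sign_matrix :: "('n \<Rightarrow> real) \<Rightarrow> real^'n^'n" where
  "sign_matrix \<epsilon> = (\<chi> i j. if i = j then \<epsilon> i else 0)"

definition sign_group :: "(real^'n^'n) set" where
  "sign_group = {sign_matrix \<epsilon> | \<epsilon>. \<forall>i. \<epsilon> i \<in> {-1, 1}}"

text \<open>For a compact matrix group \<open>G\<close>, exactly one measure satisfies this predicate.\<close>

definition normalized_haar :: "(real^'n^'n) set \<Rightarrow> (real^'n^'n) measure \<Rightarrow> bool" where
  "normalized_haar G \<mu> \<longleftrightarrow>
     prob_space \<mu> \<and> sets \<mu> = sets (restrict_space borel G) \<and>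
     (\<forall>g\<in>G. distr \<mu> \<mu> (\<lambda>x. g ** x) = \<mu>)"

definition T_hat :: "nat \<Rightarrow> real^'n::{finite,linorder} \<Rightarrow> real^'n::{finite,linorder}^'n::{finite,linorder} \<Rightarrow> real" where
  "T_hat h x M = (M *v x) \<bullet> (matrix_pow shift_matrix h *v (M *v x))"

text \<open>Conditional probability of the event \<open>{\<omega>. P \<omega>}\<close> given the \<open>\<sigma>\<close>-algebra generated by
  \<open>X\<close>, a random element of \<open>N\<close>; as a conditional expectation it is determined only almost everywhere.\<close>

definition cond_prob_given ::
    "'a measure \<Rightarrow> 'b measure \<Rightarrow> ('a \<Rightarrow> 'b) \<Rightarrow> ('a \<Rightarrow> bool) \<Rightarrow> 'a \<Rightarrow> real" where
  "cond_prob_given \<Omega> N X P =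
     real_cond_exp \<Omega> (vimage_algebra (space \<Omega>) X N) (indicator {\<omega> \<in> space \<Omega>. P \<omega>})"

lemma perm_matrix_mult_vec: "(perm_matrix p *v x) $ i = x $ p i"
  by (simp add: perm_matrix_def matrix_vector_mult_def if_distrib[where f="\<lambda>c. c * _"] cong: if_cong)

lemma sign_matrix_mult_vec: "(sign_matrix \<epsilon> *v x) $ i = \<epsilon> i * x $ i"
  by (simp add: sign_matrix_def matrix_vector_mult_def if_distrib[where f="\<lambda>c. c * _"] cong: if_cong)

lemma strict_mono_position: "strict_mono (position :: 'n::{finite,linorder} \<Rightarrow> nat)"
  unfolding position_def by (intro strict_monoI psubset_card_mono) auto

lemma bij_betw_position:
  "bij_betw (position :: 'n::{finite,linorder} \<Rightarrow> nat) UNIV {1..CARD('n)}"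
proof -
  have inj: "inj (position :: 'n \<Rightarrow> nat)"
    using strict_mono_position by (rule strict_mono_imp_inj_on)
  have sub: "range (position :: 'n \<Rightarrow> nat) \<subseteq> {1..CARD('n)}"
    by (auto simp: position_def Suc_le_eq card_gt_0_iff intro!: card_mono)
  have "range (position :: 'n \<Rightarrow> nat) = {1..CARD('n)}"
    by (rule card_subset_eq[OF _ sub]) (simp_all add: card_image[OF inj])
  with inj show ?thesis by (simp add: bij_betw_def)
qed

lemma matrix_pow_shift:
  "matrix_pow (shift_matrix :: real^'n::{finite,linorder}^'n::{finite,linorder}) h $ i $ j =
     (if position j = position i + h then 1 else 0)"
proof (induction h arbitrary: i)
  case 0
  have "position j = position i \<longleftrightarrow> i = j"
    using strict_mono_eq[OF strict_mono_position] by metis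
  then show ?case by (simp add: mat_def)
next
  case (Suc h)
  have eq: "matrix_pow (shift_matrix :: real^'n::{finite,linorder}^'n::{finite,linorder}) (Suc h) $ i $ j =
      (\<Sum>k\<in>(UNIV::'n set). if position k = position i + 1 \<and> position j = position k + h then 1 else 0)"
    unfolding matrix_pow.simps matrix_matrix_mult_def vec_lambda_beta Suc
    by (rule sum.cong) (simp_all add: shift_matrix_def)
  show ?case
  proof (cases "position j = position i + Suc h")
    case True
    have "position i + 1 \<in> {1..CARD('n)}"
      using True bij_betwE[OF bij_betw_position, rule_format, of j] by auto
    then obtain k where k: "position (k::'n) = position i + 1"
      using bij_betw_imp_surj_on[OF bij_betw_position[where 'n='n]] by (metis imageE)
    have "(position k' = position i + 1 \<and> position j = position k' + h) \<longleftrightarrow> k' = k" for k'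
      using True k strict_mono_eq[OF strict_mono_position, of k' k] by auto
    then show ?thesis using True unfolding eq by simp
  next
    case False
    then show ?thesis unfolding eq by (intro trans[OF sum.neutral]) auto
  qed
qed

lemma T_hat_eq_sum:
  fixes x :: "real^'n::{finite,linorder}"
  shows "T_hat h x M =
    (\<Sum>(i, j) | position j = position i + h. (M *v x) $ i * (M *v x) $ j)"
proof -
  have *: "inner y (matrix_pow shift_matrix h *v y) =
      (\<Sum>i\<in>UNIV. \<Sum>j\<in>UNIV. if position j = position i + h then y $ i * y $ j else 0)"
    for y :: "real^'n::{finite,linorder}"
    by (auto simp: inner_vec_def matrix_vector_mult_def sum_distrib_left matrix_pow_shift
        intro!: sum.cong)
  show ?thesis
    unfolding T_hat_def * sum.cartesian_product
    by (rule sum.mono_neutral_cong_right) (auto split: if_split_asm)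
qed

lemma sets_restrict_borel_finite:
  fixes G :: "(real^'n^'n) set"
  assumes "finite G"
  shows "sets (restrict_space borel G) = Pow G"
proof -
  have "A \<in> sets (restrict_space borel G)" if "A \<subseteq> G" for A
  proof -
    have "A = G \<inter> A" "A \<in> sets borel"
      using that finite_subset[OF that assms] by (auto intro: borel_closed finite_imp_closed)
    then show ?thesis by (auto simp: sets_restrict_space)
  qed
  then show ?thesis by (auto simp: sets_restrict_space)
qed

lemma normalized_haar_finite:
  fixes G :: "(real^'n^'n) set"
  assumes fin: "finite G" and ne: "G \<noteq> {}"
    and mult: "\<And>x y. x \<in> G \<Longrightarrow> y \<in> G \<Longrightarrow> x ** y \<in> G"
    and transitive: "\<And>x y. x \<in> G \<Longrightarrow> y \<in> G \<Longrightarrow> \<exists>g\<in>G. g ** x = y"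
    and inj: "\<And>g. g \<in> G \<Longrightarrow> inj_on (\<lambda>x. g ** x) G"
  shows "normalized_haar G \<mu> \<longleftrightarrow> \<mu> = uniform_count_measure G"
proof
  assume "normalized_haar G \<mu>"
  then have P: "prob_space \<mu>" and S: "sets \<mu> = Pow G"
    and inv: "\<And>g. g \<in> G \<Longrightarrow> distr \<mu> \<mu> (\<lambda>x. g ** x) = \<mu>"
    by (auto simp: normalized_haar_def sets_restrict_borel_finite[OF fin])
  interpret prob_space \<mu> by (rule P)
  have sp: "space \<mu> = G" using sets_eq_imp_space_eq[of \<mu> "count_space G"] S by simp
  have le: "emeasure \<mu> {x} \<le> emeasure \<mu> {y}" if xy: "x \<in> G" "y \<in> G" for x y
  proof -
    obtain g where g: "g \<in> G" "g ** x = y" using transitive[OF xy] by blast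
    have meas: "(\<lambda>x. g ** x) \<in> measurable \<mu> \<mu>"
      by (rule measurableI) (auto simp: sp S g mult)
    have "emeasure \<mu> {x} \<le> emeasure \<mu> ((\<lambda>x. g ** x) -` {y} \<inter> space \<mu>)"
      using xy g by (intro emeasure_mono) (auto simp: sp S)
    also have "\<dots> = emeasure (distr \<mu> \<mu> (\<lambda>x. g ** x)) {y}"
      using meas xy by (subst emeasure_distr) (auto simp: S)
    finally show ?thesis by (simp add: inv[OF g(1)])
  qed
  obtain a where a: "a \<in> G" using ne by blast
  have const: "emeasure \<mu> {x} = emeasure \<mu> {a}" if "x \<in> G" for x
    using le[OF that a] le[OF a that] by (rule antisym)
  have sum: "emeasure \<mu> A = of_nat (card A) * emeasure \<mu> {a}" if "A \<subseteq> G" for A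
  proof -
    have "emeasure \<mu> A = (\<Sum>x\<in>A. emeasure \<mu> {x})"
      using that finite_subset[OF that fin] by (intro emeasure_eq_sum_singleton) (auto simp: S)
    also have "\<dots> = (\<Sum>x\<in>A. emeasure \<mu> {a})"
      using that const by (intro sum.cong) auto
    finally show ?thesis by simp
  qed
  have "ennreal (real (card G) * prob {a}) = 1"
    using sum[of G] emeasure_space_1
    by (simp add: sp emeasure_eq_measure ennreal_mult ennreal_of_nat_eq_real_of_nat)
  then have pa: "prob {a} = 1 / card G"
    using ne fin by (simp add: field_simps flip: ennreal_1)
  show "\<mu> = uniform_count_measure G"
  proof (rule measure_eqI)
    show "sets \<mu> = sets (uniform_count_measure G)"
      by (simp add: S sets_uniform_count_measure)
    show "emeasure \<mu> A = emeasure (uniform_count_measure G) A" if "A \<in> sets \<mu>" for A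
      using that sum[of A] pa fin
      by (simp add: S emeasure_uniform_count_measure emeasure_eq_measure
          ennreal_of_nat_eq_real_of_nat flip: ennreal_mult)
  qed
next
  assume U: "\<mu> = uniform_count_measure G"
  have P: "prob_space \<mu>" unfolding U using fin ne by (rule prob_space_uniform_count_measure)
  have S: "sets \<mu> = Pow G" and sp: "space \<mu> = G"
    by (simp_all add: U sets_uniform_count_measure space_uniform_count_measure)
  have "distr \<mu> \<mu> (\<lambda>x. g ** x) = \<mu>" if g: "g \<in> G" for g
  proof (rule measure_eqI)
    fix A assume "A \<in> sets (distr \<mu> \<mu> (\<lambda>x. g ** x))"
    then have A: "A \<subseteq> G" by (simp add: S)
    have meas: "(\<lambda>x. g ** x) \<in> measurable \<mu> \<mu>"
      by (rule measurableI) (auto simp: sp S g mult)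
    have "bij_betw (\<lambda>x. g ** x) G G"
      using inj[OF g] fin mult[OF g]
      by (metis bij_betw_def endo_inj_surj image_subsetI)
    then have "bij_betw (\<lambda>x. g ** x) ((\<lambda>x. g ** x) -` A \<inter> G) A"
    proof -
      assume bij: "bij_betw (\<lambda>x. g ** x) G G"
      have "(\<lambda>x. g ** x) ` ((\<lambda>x. g ** x) -` A \<inter> G) = A"
      proof (intro equalityI subsetI)
        fix y assume y: "y \<in> A"
        then have "y \<in> (\<lambda>x. g ** x) ` G"
          using A bij by (auto simp: bij_betw_def)
        then show "y \<in> (\<lambda>x. g ** x) ` ((\<lambda>x. g ** x) -` A \<inter> G)"
          using y by blast
      qed auto
      then show ?thesis by (intro bij_betw_subset[OF bij]) auto
    qed
    then have "card ((\<lambda>x. g ** x) -` A \<inter> G) = card A" by (rule bij_betw_same_card)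
    then show "emeasure (distr \<mu> \<mu> (\<lambda>x. g ** x)) A = emeasure \<mu> A"
      using meas A fin
      by (subst emeasure_distr) (auto simp: sp S U emeasure_uniform_count_measure space_uniform_count_measure sets_uniform_count_measure)
  qed simp
  then show "normalized_haar G \<mu>"
    using P by (simp add: normalized_haar_def S sets_restrict_borel_finite[OF fin])
qed

end

theory Submission
  imports Defs
begin

text \<open>Conditioning on \<open>X\<close> reduces the claim to a fixed unit vector \<open>x\<close> and a Haar matrix \<open>M\<close>. Since
  \<open>\<bar>T_hat h x M\<bar> \<le> 1\<close>, only \<open>t \<le> 1\<close> matters, and for the two finite groups the stated bounds are then so
  close to \<open>1\<close> that \<open>\<bar>T_hat h x M\<bar> \<le> 1\<close> together with a nonpositive expectation suffices:
  \<open>P (T \<ge> t) \<le> 1 / (1 + t)\<close>. For \<open>SO(n)\<close> the law of \<open>M x\<close> is that of a normalized Gaussian vector \<open>g\<close>,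
  and \<open>P (T(g) \<ge> t \<bar>g\<bar>\<^sup>2)\<close> is bounded by the Chernoff method. The required Gaussian integral of the
  exponential of a quadratic form is estimated without diagonalization: the graph joining \<open>i\<close> and
  \<open>i + h\<close> is bipartite, so the form is linear in the coordinates of one class given those of the other.\<close>

subsection \<open>Gaussian integrals of bipartite quadratic forms\<close>

lemma nn_integral_lborel_translate:
  fixes a :: "'a::euclidean_space"
  assumes f: "f \<in> borel_measurable borel"
  shows "(\<integral>\<^sup>+x. f (a + x) \<partial>lborel) = (\<integral>\<^sup>+x. f x \<partial>lborel)"
proof -
  have "(\<integral>\<^sup>+x. f x \<partial>lborel) = (\<integral>\<^sup>+x. f x \<partial>distr lborel borel ((+) a))"
    by (simp add: lborel_distr_plus)
  also have "\<dots> = (\<integral>\<^sup>+x. f (a + x) \<partial>lborel)"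
    using f by (subst nn_integral_distr) auto
  finally show ?thesis ..
qed

text \<open>Uniqueness of translation invariant measures, with the unit ball as the set on which the two
  measures are known to agree.\<close>

lemma distr_lborel_orthogonal:
  fixes f :: "'a::euclidean_space \<Rightarrow> 'a"
  assumes f: "orthogonal_transformation f"
  shows "distr lborel borel f = lborel"
proof -
  define \<nu> where "\<nu> = distr lborel borel f"
  define E :: "'a set" where "E = ball 0 1"
  have lin: "linear f" and surj: "surj f" and nrm: "\<And>x. norm (f x) = norm x"
    using f by (auto simp: orthogonal_transformation_linear orthogonal_transformation_surj
        orthogonal_transformation_norm)
  have meas[measurable]: "f \<in> borel_measurable borel"
    using lin by (intro borel_measurable_continuous_onI linear_continuous_on) (simp add: linear_conv_bounded_linear)
  have sets_nu [simp, measurable_cong]: "sets \<nu> = sets borel" and space_nu [simp]: "space \<nu> = UNIV"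
    by (simp_all add: \<nu>_def)
  have [measurable]: "E \<in> sets borel" by (simp add: E_def)
  have nu_ball: "emeasure \<nu> (ball 0 r) = emeasure lborel (ball (0::'a) r)" for r
  proof -
    have "f -` ball 0 r = ball 0 r" by (auto simp: nrm)
    then show ?thesis by (simp add: \<nu>_def emeasure_distr)
  qed
  then have nu_E: "emeasure \<nu> E = emeasure lborel E" by (simp add: E_def)
  interpret \<nu>: sigma_finite_measure \<nu>
  proof
    show "\<exists>A. countable A \<and> A \<subseteq> sets \<nu> \<and> \<Union>A = space \<nu> \<and> (\<forall>a\<in>A. emeasure \<nu> a \<noteq> \<infinity>)"
    proof (intro exI[of _ "range (\<lambda>n::nat. ball 0 (real n))"] conjI)
      show "\<Union>(range (\<lambda>n::nat. ball 0 (real n))) = space \<nu>"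
        using reals_Archimedean2 by auto
      show "\<forall>a\<in>range (\<lambda>n::nat. ball 0 (real n)). emeasure \<nu> a \<noteq> \<infinity>"
        by (auto simp: nu_ball emeasure_lborel_ball_finite[THEN less_imp_neq, simplified])
    qed auto
  qed
  interpret P: pair_sigma_finite \<nu> "lborel :: 'a measure" ..
  have nu_translate: "(\<integral>\<^sup>+y. g (x + y) \<partial>\<nu>) = (\<integral>\<^sup>+y. g y \<partial>\<nu>)"
    if [measurable]: "g \<in> borel_measurable borel" for g :: "'a \<Rightarrow> ennreal" and x
  proof -
    \<comment> \<open>By linearity, a translation by \<open>f a\<close> after \<open>f\<close> is
      \<open>f\<close> after a translation by \<open>a\<close>, so translation invariance passes
      from Lebesgue measure to its image.\<close>
    obtain a where a: "x = f a" using surj by blast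
    have "(\<integral>\<^sup>+y. g (x + y) \<partial>\<nu>) = (\<integral>\<^sup>+y. g (f (a + y)) \<partial>lborel)"
      unfolding \<nu>_def a by (subst nn_integral_distr) (auto simp: linear_add[OF lin])
    also have "\<dots> = (\<integral>\<^sup>+y. g (f y) \<partial>lborel)"
      by (rule nn_integral_lborel_translate[of "\<lambda>y. g (f y)"]) measurable
    also have "\<dots> = (\<integral>\<^sup>+y. g y \<partial>\<nu>)"
      unfolding \<nu>_def by (subst nn_integral_distr) auto
    finally show ?thesis .
  qed
  have pos: "emeasure lborel E \<noteq> 0" "emeasure lborel E \<noteq> \<infinity>"
    using emeasure_lborel_ball_finite[of "0::'a" 1] content_ball_pos[of 1 "0::'a"]
    by (auto simp: E_def measure_def)
  have "emeasure \<nu> A = emeasure lborel A" if [measurable]: "A \<in> sets borel" for A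
  proof -
    \<comment> \<open>Both measures are translated in turn inside one double integral: first the
      \<open>\<nu>\<close> variable by \<open>x\<close>, then the Lebesgue variable by
      \<open>- y\<close>, then the \<open>\<nu>\<close> variable back. This moves \<open>A\<close>
      from \<open>\<nu>\<close> to Lebesgue measure and \<open>E\<close> the other way; since
      \<open>E\<close> has the same positive finite mass for both, it cancels.\<close>
    have "emeasure \<nu> A * emeasure lborel E = (\<integral>\<^sup>+x. \<integral>\<^sup>+y. indicator A y * indicator E x \<partial>\<nu> \<partial>lborel)"
      by (simp add: nn_integral_multc nn_integral_cmult)
    also have "\<dots> = (\<integral>\<^sup>+x. \<integral>\<^sup>+y. indicator A (x + y) * indicator E x \<partial>\<nu> \<partial>lborel)"
      by (intro nn_integral_cong nu_translate[symmetric]) measurable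
    also have "\<dots> = (\<integral>\<^sup>+y. \<integral>\<^sup>+x. indicator A (y + x) * indicator E x \<partial>lborel \<partial>\<nu>)"
      by (subst P.Fubini') (auto simp: add.commute)
    also have "\<dots> = (\<integral>\<^sup>+y. \<integral>\<^sup>+x. indicator A (y + x) * indicator E ((y + x) + - y) \<partial>lborel \<partial>\<nu>)"
      by simp
    also have "\<dots> = (\<integral>\<^sup>+y. \<integral>\<^sup>+x. indicator A x * indicator E (x + - y) \<partial>lborel \<partial>\<nu>)"
      by (intro nn_integral_cong nn_integral_lborel_translate[of "\<lambda>x. indicator A x * indicator E (x + - _)"]) measurable
    \<comment> \<open>The ball is symmetric about the origin, so \<open>x - y\<close> may be
      replaced by \<open>- x + y\<close>, a translate in the \<open>\<nu>\<close> variable.\<close>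
    also have "\<dots> = (\<integral>\<^sup>+x. \<integral>\<^sup>+y. indicator A x * indicator E (- x + y) \<partial>\<nu> \<partial>lborel)"
      by (subst P.Fubini') (auto simp: E_def dist_norm norm_minus_commute indicator_def intro!: nn_integral_cong)
    also have "\<dots> = (\<integral>\<^sup>+x. \<integral>\<^sup>+y. indicator A x * indicator E y \<partial>\<nu> \<partial>lborel)"
      by (intro nn_integral_cong nu_translate[of "\<lambda>y. indicator A _ * indicator E y"]) measurable
    also have "\<dots> = emeasure lborel A * emeasure lborel E"
      by (simp add: nn_integral_multc nn_integral_cmult nu_E)
    finally show ?thesis
      using pos by (metis ennreal_divide_times ennreal_mult_divide_eq infinity_ennreal_def)
  qed
  then show ?thesis
    by (intro measure_eqI) (auto simp: \<nu>_def)
qed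

section \<open>Lebesgue measure as a product measure, and Gaussian integrals\<close>

lemma measurable_vec_lambda_PiM [measurable]:
  "(\<lambda>f. \<chi> i. f i) \<in> borel_measurable (Pi\<^sub>M UNIV (\<lambda>_::'n::finite. lborel :: real measure))"
proof -
  have "(\<lambda>f. (\<chi> i. f i) \<bullet> b) \<in> borel_measurable (Pi\<^sub>M UNIV (\<lambda>_::'n. lborel :: real measure))"
    if "b \<in> Basis" for b :: "real^'n"
    using that by (auto simp: Basis_vec_def inner_axis)
  then show ?thesis by (rule borel_measurable_euclidean_space[THEN iffD2, rule_format])
qed

text \<open>A product over an index set can be split by Fubini along any partition of the
  coordinates, here the two classes of a bipartition. Lebesgue measure is determined by its values
  on boxes, and these factor.\<close>

lemma lborel_vec_eq_distr_PiM:
  "distr (Pi\<^sub>M UNIV (\<lambda>_::'n::finite. lborel)) borel (\<lambda>f. \<chi> i. f i) = (lborel :: (real^'n) measure)"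
proof (rule lborel_eqI[symmetric])
  interpret product_sigma_finite "\<lambda>_::'n. lborel :: real measure" ..
  fix l u :: "real^'n"
  assume lu: "\<And>b. b \<in> Basis \<Longrightarrow> l \<bullet> b \<le> u \<bullet> b"
  have le: "l $ i \<le> u $ i" for i
    using lu[of "axis i 1"] by (simp add: inner_axis)
  have "emeasure (distr (Pi\<^sub>M UNIV (\<lambda>_::'n. lborel)) borel (\<lambda>f. \<chi> i. f i)) (box l u)
      = emeasure (Pi\<^sub>M UNIV (\<lambda>_. lborel)) (\<Pi>\<^sub>E i\<in>UNIV. box (l $ i) (u $ i))"
    by (subst emeasure_distr)
       (auto simp: space_PiM PiE_def Pi_def mem_box_cart intro!: arg_cong2[where f=emeasure])
  also have "\<dots> = (\<Prod>i\<in>UNIV. ennreal (u $ i - l $ i))"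
    using le by (subst emeasure_PiM) auto
  also have "\<dots> = ennreal (\<Prod>i\<in>UNIV. u $ i - l $ i)"
    using le by (intro prod_ennreal) auto
  also have "(\<Prod>i\<in>UNIV. u $ i - l $ i) = (\<Prod>b\<in>Basis. (u - l) \<bullet> b)"
  proof -
    have B: "(Basis :: (real^'n) set) = range (\<lambda>i. axis i 1)" by (auto simp: Basis_vec_def)
    have "inj (\<lambda>i::'n. axis i (1::real))" by (auto simp: inj_on_def axis_eq_axis)
    then show ?thesis unfolding B by (subst prod.reindex) (auto simp: inner_axis)
  qed
  finally show "emeasure (distr (Pi\<^sub>M UNIV (\<lambda>_::'n. lborel)) borel (\<lambda>f. \<chi> i. f i)) (box l u)
      = (\<Prod>b\<in>Basis. (u - l) \<bullet> b)" .
qed simp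

text \<open>Completing the square exhibits the integrand as a constant times the normal density with
  mean \<open>b / (2 * a)\<close> and variance \<open>1 / (2 * a)\<close>, which has mass 1.\<close>

lemma nn_integral_exp_quadratic:
  fixes a b :: real
  assumes a: "a > 0"
  shows "(\<integral>\<^sup>+x. exp (b * x - a * x\<^sup>2) \<partial>lborel) = ennreal (sqrt (pi / a) * exp (b\<^sup>2 / (4 * a)))"
proof -
  define \<sigma> where "\<sigma> = sqrt (1 / (2 * a))"
  have s: "\<sigma> > 0" "\<sigma>\<^sup>2 = 1 / (2 * a)" using a by (auto simp: \<sigma>_def)
  interpret N: prob_space "density lborel (normal_density (b / (2 * a)) \<sigma>)"
    using s by (rule_tac prob_space_normal_density)
  have one: "(\<integral>\<^sup>+x. normal_density (b / (2 * a)) \<sigma> x \<partial>lborel) = 1"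
    using N.emeasure_space_1 by (simp add: emeasure_density)
  have "exp (b * x - a * x\<^sup>2) =
      (sqrt (pi / a) * exp (b\<^sup>2 / (4 * a))) * normal_density (b / (2 * a)) \<sigma> x" for x
  proof -
    have "sqrt (2 * pi * \<sigma>\<^sup>2) = sqrt (pi / a)" by (simp add: s)
    moreover have "- (x - b / (2 * a))\<^sup>2 / (2 * \<sigma>\<^sup>2) = b * x - a * x\<^sup>2 - b\<^sup>2 / (4 * a)"
      unfolding s using a by (simp add: field_simps power2_eq_square)
    ultimately show ?thesis
      using a by (simp add: normal_density_def exp_diff)
  qed
  then have "(\<integral>\<^sup>+x. exp (b * x - a * x\<^sup>2) \<partial>lborel) =
     (\<integral>\<^sup>+x. ennreal (sqrt (pi / a) * exp (b\<^sup>2 / (4 * a))) * normal_density (b / (2 * a)) \<sigma> x \<partial>lborel)"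
    using a by (intro nn_integral_cong) (simp add: ennreal_mult[symmetric])
  also have "\<dots> = ennreal (sqrt (pi / a) * exp (b\<^sup>2 / (4 * a)))"
    using a by (subst nn_integral_cmult) (auto simp: one)
  finally show ?thesis .
qed

text \<open>Cauchy-Schwarz with each weight split into two square roots puts the column sums in
  front; exchanging the sums then brings in the row sums. This bounds the operator norm of
  \<open>W\<close> by \<open>k\<close> without spectral theory.\<close>

lemma Schur_test:
  fixes W :: "'a \<Rightarrow> 'b \<Rightarrow> real"
  assumes nonneg: "\<And>b c. W b c \<ge> 0"
    and col: "\<And>c. c \<in> C \<Longrightarrow> (\<Sum>b\<in>B. W b c) \<le> k" and row: "\<And>b. b \<in> B \<Longrightarrow> (\<Sum>c\<in>C. W b c) \<le> k"
    and k: "k \<ge> 0"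
  shows "(\<Sum>c\<in>C. (\<Sum>b\<in>B. W b c * x b)\<^sup>2) \<le> k\<^sup>2 * (\<Sum>b\<in>B. (x b)\<^sup>2)"
proof -
  have "(\<Sum>b\<in>B. W b c * x b)\<^sup>2 \<le> k * (\<Sum>b\<in>B. W b c * (x b)\<^sup>2)" if c: "c \<in> C" for c
  proof -
    have "(\<Sum>b\<in>B. W b c * x b) = (\<Sum>b\<in>B. sqrt (W b c) * (sqrt (W b c) * x b))"
      using nonneg by (simp add: mult.assoc[symmetric])
    then have "(\<Sum>b\<in>B. W b c * x b)\<^sup>2 \<le> (\<Sum>b\<in>B. (sqrt (W b c))\<^sup>2) * (\<Sum>b\<in>B. (sqrt (W b c) * x b)\<^sup>2)"
      by (metis Cauchy_Schwarz_ineq_sum)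
    also have "\<dots> = (\<Sum>b\<in>B. W b c) * (\<Sum>b\<in>B. W b c * (x b)\<^sup>2)"
      using nonneg by (simp add: power_mult_distrib)
    also have "\<dots> \<le> k * (\<Sum>b\<in>B. W b c * (x b)\<^sup>2)"
      using nonneg col[OF c] by (intro mult_right_mono sum_nonneg) auto
    finally show ?thesis .
  qed
  then have "(\<Sum>c\<in>C. (\<Sum>b\<in>B. W b c * x b)\<^sup>2) \<le> (\<Sum>c\<in>C. k * (\<Sum>b\<in>B. W b c * (x b)\<^sup>2))"
    by (rule sum_mono)
  also have "\<dots> = k * (\<Sum>b\<in>B. (\<Sum>c\<in>C. W b c) * (x b)\<^sup>2)"
    unfolding sum_distrib_left[symmetric] sum_distrib_right by (subst sum.swap) simp
  also have "\<dots> \<le> k * (\<Sum>b\<in>B. k * (x b)\<^sup>2)"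
    using row k by (intro mult_left_mono sum_mono mult_right_mono) auto
  finally show ?thesis by (simp add: sum_distrib_left power2_eq_square mult.assoc)
qed

lemma nn_integral_lborel_vec:
  fixes f :: "real^'n \<Rightarrow> ennreal"
  assumes f: "f \<in> borel_measurable borel"
  shows "(\<integral>\<^sup>+y. f y \<partial>lborel) = (\<integral>\<^sup>+y. f (\<chi> i. y i) \<partial>Pi\<^sub>M UNIV (\<lambda>_. lborel))"
  using f by (subst lborel_vec_eq_distr_PiM[symmetric], subst nn_integral_distr) auto

lemma power2_norm_vec: "(norm (y :: real^'n))\<^sup>2 = (\<Sum>i\<in>UNIV. (y $ i)\<^sup>2)"
  by (simp add: norm_vec_def L2_set_def sum_nonneg)

lemma nn_integral_exp_minus_norm_square:
  assumes a: "a > 0"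
  shows "(\<integral>\<^sup>+y. exp (- (a * (norm (y :: real^'n))\<^sup>2)) \<partial>lborel) = ennreal (sqrt (pi / a) ^ CARD('n))"
proof -
  interpret product_sigma_finite "\<lambda>_::'n. lborel :: real measure" ..
  \<comment> \<open>The vanishing linear term \<open>0 * y i\<close> gives each factor the shape of
    \<open>nn_integral_exp_quadratic\<close> with \<open>b = 0\<close>.\<close>
  have "(\<integral>\<^sup>+y. exp (- (a * (norm (y :: real^'n))\<^sup>2)) \<partial>lborel)
      = (\<integral>\<^sup>+y. (\<Prod>i\<in>UNIV. ennreal (exp (0 * y i - a * (y i)\<^sup>2))) \<partial>Pi\<^sub>M (UNIV :: 'n set) (\<lambda>_. lborel))"
    by (subst nn_integral_lborel_vec)
       (auto simp: prod_ennreal exp_sum[symmetric] sum_negf sum_distrib_left power2_norm_vec)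
  also have "\<dots> = (\<Prod>i\<in>(UNIV::'n set). ennreal (sqrt (pi / a)))"
    using a by (subst product_nn_integral_prod) (auto simp: nn_integral_exp_quadratic[of a 0, simplified])
  finally show ?thesis using a by (simp add: ennreal_power)
qed

text \<open>With the coordinates in \<open>B\<close> frozen at \<open>x\<close>, the exponent is
  linear plus minus a square in each remaining coordinate, and integrating these out leaves the
  factor \<open>exp ((s * S x c)^2 / 4)\<close> for every \<open>c\<close>. By the Schur test the
  sum of the \<open>(S x c)^2\<close> is at most 4 times the squared norm of \<open>x\<close> on
  \<open>B\<close>, so the weight on \<open>B\<close> is still Gaussian, with \<open>1 - s^2\<close>
  in place of 1.\<close>

lemma nn_integral_exp_bipartite_form_le:
  fixes W :: "'n::finite \<Rightarrow> 'n \<Rightarrow> real"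
  assumes sym: "\<And>i j. W i j = W j i" and nonneg: "\<And>i j. W i j \<ge> 0"
    and row: "\<And>i. (\<Sum>j\<in>UNIV. W i j) \<le> 2"
    and bip: "\<And>i j. i \<in> B \<longleftrightarrow> j \<in> B \<Longrightarrow> W i j = 0"
    and s: "s\<^sup>2 < 1"
  shows "(\<integral>\<^sup>+y. exp (s * ((\<Sum>i\<in>UNIV. \<Sum>j\<in>UNIV. W i j * y $ i * y $ j) / 2) - (norm (y :: real^'n))\<^sup>2) \<partial>lborel)
    \<le> ennreal (sqrt (pi / (1 - s\<^sup>2)) ^ CARD('n))"
proof -
  interpret product_sigma_finite "\<lambda>_::'n. lborel :: real measure" ..
  define C where "C = - B"
  have U: "UNIV = B \<union> C" "B \<inter> C = {}" by (auto simp: C_def)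
  define q where "q z = (\<Sum>i\<in>UNIV. \<Sum>j\<in>UNIV. W i j * z i * z j) / 2" for z :: "'n \<Rightarrow> real"
  define S where "S x c = (\<Sum>b\<in>B. W b c * x b)" for x :: "'n \<Rightarrow> real" and c
  have Su: "(\<Sum>i\<in>UNIV. g i) = (\<Sum>i\<in>B. g i) + (\<Sum>i\<in>C. g i)" for g :: "'n \<Rightarrow> real"
    unfolding U(1) using U(2) by (subst sum.union_disjoint) auto
  \<comment> \<open>The diagonal blocks vanish and the two off-diagonal blocks agree by symmetry, so
    halving leaves one of them.\<close>
  have q: "q z = (\<Sum>c\<in>C. S z c * z c)" for z
  proof -
    have 1: "(\<Sum>i\<in>B. \<Sum>j\<in>B. W i j * z i * z j) = 0" "(\<Sum>i\<in>C. \<Sum>j\<in>C. W i j * z i * z j) = 0"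
      by (auto intro!: sum.neutral simp: bip C_def)
    have 2: "(\<Sum>i\<in>B. \<Sum>j\<in>C. W i j * z i * z j) = (\<Sum>c\<in>C. S z c * z c)"
      by (subst sum.swap) (simp add: S_def sum_distrib_right)
    have 3: "(\<Sum>i\<in>C. \<Sum>j\<in>B. W i j * z i * z j) = (\<Sum>c\<in>C. S z c * z c)"
      unfolding S_def sum_distrib_right by (intro sum.cong refl) (subst sym, simp)
    show ?thesis unfolding q_def Su sum.distrib 1 2 3 by simp
  qed
  have S_le: "(\<Sum>c\<in>C. (S x c)\<^sup>2) \<le> 4 * (\<Sum>b\<in>B. (x b)\<^sup>2)" for x
  proof -
    \<comment> \<open>Nonnegativity lets the full row bound control the rows of a block, and
      symmetry its columns.\<close>
    have r: "(\<Sum>j\<in>A. W i j) \<le> 2" for A i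
      using sum_mono2[of UNIV A "W i"] row[of i] nonneg by fastforce
    have "(\<Sum>c\<in>C. (S x c)\<^sup>2) \<le> 2\<^sup>2 * (\<Sum>b\<in>B. (x b)\<^sup>2)"
      unfolding S_def using nonneg r by (intro Schur_test) (auto simp: sym[of _ "_ :: 'n"])
    then show ?thesis by simp
  qed
  have "(\<integral>\<^sup>+y. exp (s * ((\<Sum>i\<in>UNIV. \<Sum>j\<in>UNIV. W i j * y $ i * y $ j) / 2) - (norm (y :: real^'n))\<^sup>2) \<partial>lborel)
    = (\<integral>\<^sup>+z. exp (s * q z - (\<Sum>i\<in>UNIV. (z i)\<^sup>2)) \<partial>Pi\<^sub>M (B \<union> C) (\<lambda>_. lborel))"
    unfolding U(1)[symmetric]
    by (subst nn_integral_lborel_vec)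
       (auto simp: q_def power2_norm_vec)
  also have "\<dots> = (\<integral>\<^sup>+x. \<integral>\<^sup>+y. exp (s * q (merge B C (x, y)) - (\<Sum>i\<in>UNIV. (merge B C (x, y) i)\<^sup>2))
        \<partial>Pi\<^sub>M C (\<lambda>_. lborel) \<partial>Pi\<^sub>M B (\<lambda>_. lborel))"
    using U unfolding q_def by (intro product_nn_integral_fold) auto
  also have "\<dots> = (\<integral>\<^sup>+x. \<integral>\<^sup>+y. ennreal (exp (- (\<Sum>b\<in>B. (x b)\<^sup>2))) *
        (\<Prod>c\<in>C. ennreal (exp ((s * S x c) * y c - 1 * (y c)\<^sup>2))) \<partial>Pi\<^sub>M C (\<lambda>_. lborel) \<partial>Pi\<^sub>M B (\<lambda>_. lborel))"
  proof (intro nn_integral_cong)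
    fix x y :: "'n \<Rightarrow> real"
    have "S (merge B C (x, y)) c = S x c" for c
      unfolding S_def using U(2) by (intro sum.cong) auto
    then have "q (merge B C (x, y)) = (\<Sum>c\<in>C. S x c * y c)"
      unfolding q using U(2) by (intro sum.cong) auto
    moreover have "(\<Sum>i\<in>UNIV. (merge B C (x, y) i)\<^sup>2) = (\<Sum>b\<in>B. (x b)\<^sup>2) + (\<Sum>c\<in>C. (y c)\<^sup>2)"
      unfolding Su using U(2) by (intro arg_cong2[where f="(+)"] sum.cong) auto
    ultimately show "ennreal (exp (s * q (merge B C (x, y)) - (\<Sum>i\<in>UNIV. (merge B C (x, y) i)\<^sup>2))) =
        ennreal (exp (- (\<Sum>b\<in>B. (x b)\<^sup>2))) * (\<Prod>c\<in>C. ennreal (exp ((s * S x c) * y c - 1 * (y c)\<^sup>2)))"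
      by (simp add: prod_ennreal exp_sum[symmetric] ennreal_mult[symmetric] exp_add[symmetric]
          sum_subtractf sum_distrib_left mult.assoc)
  qed
  also have "\<dots> = (\<integral>\<^sup>+x. ennreal (exp (- (\<Sum>b\<in>B. (x b)\<^sup>2))) *
        (\<Prod>c\<in>C. ennreal (sqrt (pi / 1) * exp ((s * S x c)\<^sup>2 / (4 * 1)))) \<partial>Pi\<^sub>M B (\<lambda>_. lborel))"
    by (intro nn_integral_cong, subst nn_integral_cmult, measurable)
       (subst product_nn_integral_prod, auto simp: nn_integral_exp_quadratic[of 1, simplified])
  also have "\<dots> \<le> (\<integral>\<^sup>+x. ennreal (sqrt pi ^ card C) * (\<Prod>b\<in>B. ennreal (exp (0 * x b - (1 - s\<^sup>2) * (x b)\<^sup>2)))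
        \<partial>Pi\<^sub>M B (\<lambda>_. lborel))"
  proof (intro nn_integral_mono)
    fix x :: "'n \<Rightarrow> real"
    have "(\<Sum>c\<in>C. (s * S x c)\<^sup>2 / 4) \<le> s\<^sup>2 * (\<Sum>b\<in>B. (x b)\<^sup>2)"
    proof -
      have "(\<Sum>c\<in>C. (s * S x c)\<^sup>2 / 4) = s\<^sup>2 / 4 * (\<Sum>c\<in>C. (S x c)\<^sup>2)"
        by (simp add: sum_distrib_left power_mult_distrib)
      also have "\<dots> \<le> s\<^sup>2 / 4 * (4 * (\<Sum>b\<in>B. (x b)\<^sup>2))"
        by (intro mult_left_mono S_le) auto
      finally show ?thesis by simp
    qed
    moreover have "(\<Sum>b\<in>B. - ((1 - s\<^sup>2) * (x b)\<^sup>2)) = - ((1 - s\<^sup>2) * (\<Sum>b\<in>B. (x b)\<^sup>2))"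
      by (simp add: sum_negf sum_distrib_left)
    ultimately have "exp (- (\<Sum>b\<in>B. (x b)\<^sup>2)) * exp (\<Sum>c\<in>C. (s * S x c)\<^sup>2 / 4)
        \<le> exp (\<Sum>b\<in>B. - ((1 - s\<^sup>2) * (x b)\<^sup>2))"
      by (simp add: exp_add[symmetric] left_diff_distrib)
    then have "sqrt pi ^ card C * (exp (- (\<Sum>b\<in>B. (x b)\<^sup>2)) * exp (\<Sum>c\<in>C. (s * S x c)\<^sup>2 / 4))
        \<le> sqrt pi ^ card C * exp (\<Sum>b\<in>B. - ((1 - s\<^sup>2) * (x b)\<^sup>2))"
      by (intro mult_left_mono) auto
    then show "ennreal (exp (- (\<Sum>b\<in>B. (x b)\<^sup>2))) *
        (\<Prod>c\<in>C. ennreal (sqrt (pi / 1) * exp ((s * S x c)\<^sup>2 / (4 * 1))))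
      \<le> ennreal (sqrt pi ^ card C) * (\<Prod>b\<in>B. ennreal (exp (0 * x b - (1 - s\<^sup>2) * (x b)\<^sup>2)))"
      by (simp add: prod_ennreal prod.distrib exp_sum ennreal_mult[symmetric] prod_nonneg ennreal_leI mult_ac)
  qed
  also have "\<dots> = ennreal (sqrt pi ^ card C) * (\<Prod>b\<in>B. ennreal (sqrt (pi / (1 - s\<^sup>2))))"
    using s by (subst nn_integral_cmult, measurable)
      (subst product_nn_integral_prod, auto simp: nn_integral_exp_quadratic[of _ 0, simplified])
  also have "\<dots> = ennreal (sqrt pi ^ card C * sqrt (pi / (1 - s\<^sup>2)) ^ card B)"
    using s by (simp add: ennreal_power ennreal_mult)
  \<comment> \<open>The factors from \<open>C\<close> are enlarged to match those from
    \<open>B\<close>, so that the bound depends only on the dimension and not on the sizes of the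
    classes.\<close>
  also have "\<dots> \<le> ennreal (sqrt (pi / (1 - s\<^sup>2)) ^ card C * sqrt (pi / (1 - s\<^sup>2)) ^ card B)"
    using s by (intro ennreal_leI mult_right_mono power_mono real_sqrt_le_mono) (auto simp: field_simps)
  also have "sqrt (pi / (1 - s\<^sup>2)) ^ card C * sqrt (pi / (1 - s\<^sup>2)) ^ card B = sqrt (pi / (1 - s\<^sup>2)) ^ CARD('n)"
    unfolding power_add[symmetric] using card_Un_disjoint[of B C] U by (simp add: add.commute)
  finally show ?thesis .
qed

subsection \<open>Haar measure on the rotation group\<close>

lemma borel_measurable_matrix_vector_mult [measurable (raw)]:
  fixes f :: "'a \<Rightarrow> real^'n^'m" and g :: "'a \<Rightarrow> real^'n"
  assumes "f \<in> borel_measurable M" "g \<in> borel_measurable M"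
  shows "(\<lambda>x. f x *v g x) \<in> borel_measurable M"
proof -
  have "continuous_on UNIV (\<lambda>p :: (real^'n^'m) \<times> (real^'n). fst p *v snd p)"
    unfolding matrix_vector_mult_def by (intro continuous_intros)
  with assms show ?thesis by (rule borel_measurable_continuous_Pair)
qed

lemma borel_measurable_transpose [measurable]: "transpose \<in> borel_measurable (borel :: (real^'n^'m) measure)"
  unfolding transpose_def by (intro borel_measurable_continuous_onI continuous_intros)

lemma borel_measurable_matrix_mult [measurable]:
  "(\<lambda>B. A ** B) \<in> borel_measurable (borel :: (real^'n^'m) measure)" for A :: "real^'m^'k"
  unfolding matrix_matrix_mult_def by (intro borel_measurable_continuous_onI continuous_intros)

lemma normalized_haar_measurable:
  assumes "normalized_haar G \<mu>" and "f \<in> borel_measurable borel"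
  shows "f \<in> borel_measurable \<mu>"
proof -
  have "f \<in> borel_measurable (restrict_space borel G)"
    using assms(2) by (rule measurable_restrict_space1)
  then show ?thesis
    using assms(1) measurable_cong_sets[of \<mu> "restrict_space borel G" borel borel]
    by (auto simp: normalized_haar_def)
qed

lemma normalized_haar_space: "normalized_haar G \<mu> \<Longrightarrow> space \<mu> = G"
  by (auto simp: normalized_haar_def space_restrict_space dest: sets_eq_imp_space_eq)

text \<open>The push-forward along \<open>g\<close> needs left multiplication as a measurable
  self-map of \<open>\<mu>\<close>, whose sigma-algebra is the trace of the Borel sets on
  \<open>G\<close>; closedness of \<open>G\<close> under \<open>g\<close> provides this.\<close>

lemma
  assumes \<mu>: "normalized_haar G \<mu>" and g: "g \<in> G" and closed: "\<And>x. x \<in> G \<Longrightarrow> g ** x \<in> G"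
  shows normalized_haar_nn_integral_translate:
      "f \<in> borel_measurable borel \<Longrightarrow> (\<integral>\<^sup>+x. f (g ** x) \<partial>\<mu>) = (\<integral>\<^sup>+x. f x \<partial>\<mu>)"
    and normalized_haar_integral_translate:
      "f' \<in> borel_measurable borel \<Longrightarrow> (\<integral>x. f' (g ** x) \<partial>\<mu>) = (\<integral>x. f' x \<partial>\<mu> :: real)"
proof -
  have "(\<lambda>x. g ** x) \<in> \<mu> \<rightarrow>\<^sub>M restrict_space borel G"
    using closed normalized_haar_measurable[OF \<mu>, of "\<lambda>x. g ** x"]
    by (intro measurable_restrict_space2) (auto simp: normalized_haar_space[OF \<mu>])
  then have m: "(\<lambda>x. g ** x) \<in> \<mu> \<rightarrow>\<^sub>M \<mu>"
    using \<mu> measurable_cong_sets[of \<mu> \<mu> \<mu> "restrict_space borel G"] by (auto simp: normalized_haar_def)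
  have inv: "distr \<mu> \<mu> (\<lambda>x. g ** x) = \<mu>"
    using \<mu> g by (simp add: normalized_haar_def)
  show "(\<integral>\<^sup>+x. f (g ** x) \<partial>\<mu>) = (\<integral>\<^sup>+x. f x \<partial>\<mu>)" if "f \<in> borel_measurable borel"
    using nn_integral_distr[OF m, of f] normalized_haar_measurable[OF \<mu> that] by (simp add: inv)
  show "(\<integral>x. f' (g ** x) \<partial>\<mu>) = (\<integral>x. f' x \<partial>\<mu>)" if "f' \<in> borel_measurable borel"
    using integral_distr[OF m, of f'] normalized_haar_measurable[OF \<mu> that] by (simp add: inv)
qed

lemma SO_group_mult: "A \<in> SO_group \<Longrightarrow> B \<in> SO_group \<Longrightarrow> A ** B \<in> SO_group"
  by (simp add: SO_group_def rotation_matrix_def orthogonal_matrix_mul det_mul)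

lemma SO_group_transpose: "A \<in> SO_group \<Longrightarrow> transpose A \<in> SO_group"
  by (simp add: SO_group_def rotation_matrix_def orthogonal_matrix_transpose det_transpose)

lemma orthogonal_transformation_matrix_vector:
  "orthogonal_matrix A \<Longrightarrow> orthogonal_transformation ((*v) A)" for A :: "real^'n^'n"
  by (simp add: orthogonal_transformation_matrix)

lemmas orthogonal_matrix_norm =
  orthogonal_transformation_norm[OF orthogonal_transformation_matrix_vector]

text \<open>The dimension bound is essential: on the line the rotation group is trivial and cannot
  exchange a nonzero vector with its negative.\<close>

lemma SO_group_transitive:
  fixes x y :: "real^'n"
  assumes "2 \<le> CARD('n)" and "norm x = norm y"
  obtains Q where "Q \<in> SO_group" "Q *v x = y"
proof -
  obtain f where f: "orthogonal_transformation f" "det (matrix f) = 1" "f x = y"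
    using rotation_exists[OF assms] by metis
  then have "matrix f \<in> SO_group" "matrix f *v x = y"
    using orthogonal_transformation_matrix[of f] matrix_works[of f x]
    by (auto simp: SO_group_def rotation_matrix_def)
  then show thesis ..
qed

text \<open>Left invariance alone makes the law of \<open>R\<^sup>T x\<close> constant on spheres; averaging \<open>\<phi> (Q\<^sup>T R x)\<close> over two
  independent Haar matrices then identifies it with the law of \<open>R x\<close>.\<close>

lemma SO_haar_average_eq:
  fixes x :: "real^'n" and \<phi> :: "real^'n \<Rightarrow> ennreal"
  assumes \<mu>: "normalized_haar SO_group \<mu>" and n: "2 \<le> CARD('n)"
    and \<phi>[measurable]: "\<phi> \<in> borel_measurable borel" and y: "norm y = norm x"
  shows "(\<integral>\<^sup>+R. \<phi> (transpose R *v y) \<partial>\<mu>) = (\<integral>\<^sup>+R. \<phi> (R *v x) \<partial>\<mu>)"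
proof -
  interpret prob_space \<mu> using \<mu> by (simp add: normalized_haar_def)
  interpret pair_sigma_finite \<mu> \<mu> ..
  note sp = normalized_haar_space[OF \<mu>]
  have [measurable]: "(\<lambda>R. R) \<in> borel_measurable \<mu>"
    by (rule normalized_haar_measurable[OF \<mu>]) simp
  have const: "(\<integral>\<^sup>+R. \<phi> (transpose R *v z) \<partial>\<mu>) = (\<integral>\<^sup>+R. \<phi> (transpose R *v x) \<partial>\<mu>)"
    if z: "norm z = norm x" for z
  proof -
    obtain Q where Q: "Q \<in> SO_group" "Q *v x = z" using SO_group_transitive[OF n] z by metis
    \<comment> \<open>Since \<open>z = Q *v x\<close>, applying \<open>transpose R\<close> to
      \<open>z\<close> is applying the transpose of \<open>transpose Q ** R\<close> to
      \<open>x\<close>: the transposition turns a change of the vector into a left translation of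
      \<open>R\<close>.\<close>
    have "(\<integral>\<^sup>+R. \<phi> (transpose R *v z) \<partial>\<mu>) = (\<integral>\<^sup>+R. \<phi> (transpose (transpose Q ** R) *v x) \<partial>\<mu>)"
      by (simp add: Q(2)[symmetric] matrix_transpose_mul matrix_vector_mul_assoc)
    also have "\<dots> = (\<integral>\<^sup>+R. \<phi> (transpose R *v x) \<partial>\<mu>)"
    proof (rule normalized_haar_nn_integral_translate[OF \<mu>, of _ "\<lambda>R. \<phi> (transpose R *v x)"])
      show "(\<lambda>R. \<phi> (transpose R *v x)) \<in> borel_measurable borel" by measurable
    qed (use Q in \<open>auto intro: SO_group_mult SO_group_transpose\<close>)
    finally show ?thesis .
  qed
  have "(\<integral>\<^sup>+R. \<phi> (R *v x) \<partial>\<mu>) = (\<integral>\<^sup>+Q. \<integral>\<^sup>+R. \<phi> (R *v x) \<partial>\<mu> \<partial>\<mu>)"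
    by (simp add: emeasure_space_1)
  also have "\<dots> = (\<integral>\<^sup>+Q. \<integral>\<^sup>+R. \<phi> ((transpose Q ** R) *v x) \<partial>\<mu> \<partial>\<mu>)"
    by (intro nn_integral_cong normalized_haar_nn_integral_translate[OF \<mu>, of _ "\<lambda>R. \<phi> (R *v x)", symmetric])
      (auto intro: SO_group_mult SO_group_transpose simp: sp)
  also have "\<dots> = (\<integral>\<^sup>+Q. \<integral>\<^sup>+R. \<phi> (transpose Q *v (R *v x)) \<partial>\<mu> \<partial>\<mu>)"
    by (simp add: matrix_vector_mul_assoc)
  also have "\<dots> = (\<integral>\<^sup>+R. \<integral>\<^sup>+Q. \<phi> (transpose Q *v (R *v x)) \<partial>\<mu> \<partial>\<mu>)"
    by (rule Fubini') measurable
  also have "\<dots> = (\<integral>\<^sup>+R. \<integral>\<^sup>+Q. \<phi> (transpose Q *v x) \<partial>\<mu> \<partial>\<mu>)"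
    by (intro nn_integral_cong const)
      (auto simp: sp SO_group_def rotation_matrix_def orthogonal_matrix_norm)
  also have "\<dots> = (\<integral>\<^sup>+Q. \<phi> (transpose Q *v x) \<partial>\<mu>)"
    by (simp add: emeasure_space_1)
  finally show ?thesis using const[OF y] by simp
qed

text \<open>This replaces polar coordinates: a homogeneous function of degree 0 and a radial weight
  integrate independently. Rotating Lebesgue measure by \<open>transpose R\<close> and averaging
  over \<open>R\<close> turns \<open>\<phi>\<close> into its spherical average, which is the same at
  every nonzero \<open>y\<close>.\<close>

lemma SO_haar_average_radial:
  fixes x :: "real^'n" and \<phi> w :: "real^'n \<Rightarrow> ennreal"
  assumes \<mu>: "normalized_haar SO_group \<mu>" and n: "2 \<le> CARD('n)" and x: "norm x = 1"
    and \<phi>[measurable]: "\<phi> \<in> borel_measurable borel"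
    and hom: "\<And>c y. c > 0 \<Longrightarrow> \<phi> (c *\<^sub>R y) = \<phi> y"
    and w[measurable]: "w \<in> borel_measurable borel"
    and radial: "\<And>y z. norm y = norm z \<Longrightarrow> w y = w z"
  shows "(\<integral>\<^sup>+y. \<phi> y * w y \<partial>lborel) = (\<integral>\<^sup>+R. \<phi> (R *v x) \<partial>\<mu>) * (\<integral>\<^sup>+y. w y \<partial>lborel)"
proof -
  interpret prob_space \<mu> using \<mu> by (simp add: normalized_haar_def)
  interpret pair_sigma_finite \<mu> "lborel :: (real^'n) measure" ..
  note sp = normalized_haar_space[OF \<mu>]
  have [measurable]: "(\<lambda>R. R) \<in> borel_measurable \<mu>"
    by (rule normalized_haar_measurable[OF \<mu>]) simp
  have rot: "(\<integral>\<^sup>+y. \<phi> (R *v y) * w y \<partial>lborel) = (\<integral>\<^sup>+y. \<phi> y * w y \<partial>lborel)"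
    if R: "R \<in> SO_group" for R
  proof -
    have orth: "orthogonal_matrix R" using R by (simp add: SO_group_def rotation_matrix_def)
    then have "distr lborel borel ((*v) R) = lborel"
      by (intro distr_lborel_orthogonal orthogonal_transformation_matrix_vector)
    then have "(\<integral>\<^sup>+y. \<phi> y * w y \<partial>lborel) = (\<integral>\<^sup>+y. \<phi> y * w y \<partial>distr lborel borel ((*v) R))"
      by simp
    also have "\<dots> = (\<integral>\<^sup>+y. \<phi> (R *v y) * w (R *v y) \<partial>lborel)"
      by (subst nn_integral_distr) auto
    finally show ?thesis using radial[OF orthogonal_matrix_norm[OF orth]] by simp
  qed
  have "(\<integral>\<^sup>+y. \<phi> y * w y \<partial>lborel) = (\<integral>\<^sup>+R. \<integral>\<^sup>+y. \<phi> y * w y \<partial>lborel \<partial>\<mu>)"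
    by (simp add: emeasure_space_1)
  also have "\<dots> = (\<integral>\<^sup>+R. \<integral>\<^sup>+y. \<phi> (transpose R *v y) * w y \<partial>lborel \<partial>\<mu>)"
    by (intro nn_integral_cong rot[symmetric]) (auto simp: sp SO_group_transpose)
  also have "\<dots> = (\<integral>\<^sup>+y. \<integral>\<^sup>+R. \<phi> (transpose R *v y) * w y \<partial>\<mu> \<partial>lborel)"
    by (rule Fubini'[symmetric]) measurable
  also have "\<dots> = (\<integral>\<^sup>+y. (\<integral>\<^sup>+R. \<phi> (R *v x) \<partial>\<mu>) * w y \<partial>lborel)"
  proof (rule nn_integral_cong_AE)
    \<comment> \<open>The origin cannot be rescaled to the unit sphere, but it is a null
      set.\<close>
    have "AE y :: real^'n in lborel. y \<noteq> 0" by (rule AE_lborel_singleton)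
    then show "AE y in lborel. (\<integral>\<^sup>+R. \<phi> (transpose R *v y) * w y \<partial>\<mu>) = (\<integral>\<^sup>+R. \<phi> (R *v x) \<partial>\<mu>) * w y"
    proof (rule eventually_mono)
      fix y :: "real^'n" assume y: "y \<noteq> 0"
      have m: "(\<lambda>R. \<phi> (transpose R *v y)) \<in> borel_measurable \<mu>" by measurable
      have "(\<integral>\<^sup>+R. \<phi> (transpose R *v y) \<partial>\<mu>) = (\<integral>\<^sup>+R. \<phi> (transpose R *v (inverse (norm y) *\<^sub>R y)) \<partial>\<mu>)"
        using y hom[of "inverse (norm y)"] by (simp add: matrix_vector_mult_scaleR)
      also have "\<dots> = (\<integral>\<^sup>+R. \<phi> (R *v x) \<partial>\<mu>)"
        using y x by (intro SO_haar_average_eq[OF \<mu> n \<phi>]) auto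
      finally show "(\<integral>\<^sup>+R. \<phi> (transpose R *v y) * w y \<partial>\<mu>) = (\<integral>\<^sup>+R. \<phi> (R *v x) \<partial>\<mu>) * w y"
        by (simp only: nn_integral_multc[OF m])
    qed
  qed
  also have "\<dots> = (\<integral>\<^sup>+R. \<phi> (R *v x) \<partial>\<mu>) * (\<integral>\<^sup>+y. w y \<partial>lborel)"
    by (rule nn_integral_cmult) measurable
  finally show ?thesis .
qed

subsection \<open>Conditional probabilities given an independent variable\<close>

text \<open>Independence makes the joint law of \<open>Y\<close> and \<open>X\<close> a product, so
  by Fubini the candidate obtained by freezing \<open>X\<close> has the right integral over every
  event determined by \<open>X\<close>. This characterizes the conditional expectation almost
  everywhere.\<close>

lemma (in prob_space) cond_prob_given_indep:
  assumes X[measurable]: "X \<in> M \<rightarrow>\<^sub>M N" and Y[measurable]: "Y \<in> M \<rightarrow>\<^sub>M K"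
    and ind: "indep_set (sets (vimage_algebra (space M) Y K)) (sets (vimage_algebra (space M) X N))"
    and P: "{p \<in> space (K \<Otimes>\<^sub>M N). P (snd p) (fst p)} \<in> sets (K \<Otimes>\<^sub>M N)"
  shows "AE \<omega> in M. cond_prob_given M N X (\<lambda>\<omega>. P (X \<omega>) (Y \<omega>)) \<omega> =
    measure (distr M K Y) {y \<in> space K. P (X \<omega>) y}"
proof -
  define F where "F = vimage_algebra (space M) X N"
  define S where "S = {p \<in> space (K \<Otimes>\<^sub>M N). P (snd p) (fst p)}"
  define A where "A = {\<omega> \<in> space M. P (X \<omega>) (Y \<omega>)}"
  define g where "g x = measure (distr M K Y) {y \<in> space K. P x y}" for x
  have S[measurable]: "S \<in> sets (K \<Otimes>\<^sub>M N)" using P by (simp add: S_def)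
  interpret Y: prob_space "distr M K Y" by (rule prob_space_distr) measurable
  interpret X: prob_space "distr M N X" by (rule prob_space_distr) measurable
  interpret YX: pair_prob_space "distr M K Y" "distr M N X" ..
  have XS: "X \<in> space M \<rightarrow> space N" using X by (rule measurable_space[THEN funcsetI])
  have sets_F: "sets F = {X -` B \<inter> space M | B. B \<in> sets N}"
    unfolding F_def by (rule sets_vimage_algebra2[OF XS])
  have space_F: "space F = space M" by (simp add: F_def)
  interpret F: finite_measure_subalgebra M F
    by standard (auto simp: subalgebra_def space_F sets_F)
  have joint: "distr M K Y \<Otimes>\<^sub>M distr M N X = distr M (K \<Otimes>\<^sub>M N) (\<lambda>\<omega>. (Y \<omega>, X \<omega>))"
  proof (rule pair_measure_eqI)
    fix C B assume C: "C \<in> sets (distr M K Y)" and B: "B \<in> sets (distr M N X)"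
    then have [measurable]: "C \<in> sets K" "B \<in> sets N" by auto
    have "Y -` C \<inter> space M \<in> sets (vimage_algebra (space M) Y K)"
      "X -` B \<inter> space M \<in> sets (vimage_algebra (space M) X N)"
      by (auto intro: in_vimage_algebra)
    then have "prob (Y -` C \<inter> space M \<inter> (X -` B \<inter> space M)) = prob (Y -` C \<inter> space M) * prob (X -` B \<inter> space M)"
      using ind unfolding indep_sets2_eq by blast
    moreover have "Y -` C \<inter> space M \<inter> (X -` B \<inter> space M) = (\<lambda>\<omega>. (Y \<omega>, X \<omega>)) -` (C \<times> B) \<inter> space M"
      by auto
    ultimately show "emeasure (distr M K Y) C * emeasure (distr M N X) B =
        emeasure (distr M (K \<Otimes>\<^sub>M N) (\<lambda>\<omega>. (Y \<omega>, X \<omega>))) (C \<times> B)"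
      by (simp add: emeasure_distr emeasure_eq_measure ennreal_mult)
  qed (auto intro: prob_space_imp_sigma_finite X.prob_space_axioms Y.prob_space_axioms)
  have sect: "(\<lambda>y. (y, x)) -` S = {y \<in> space K. P x y}" if "x \<in> space N" for x
    using that by (auto simp: S_def space_pair_measure)
  have A_eq: "A = (\<lambda>\<omega>. (Y \<omega>, X \<omega>)) -` S \<inter> space M"
    using measurable_space[OF X] measurable_space[OF Y] by (auto simp: A_def S_def space_pair_measure)
  have A[measurable]: "A \<in> sets M" unfolding A_eq by measurable
  have g[measurable]: "g \<in> borel_measurable N"
  proof -
    have "(\<lambda>x. measure (distr M K Y) ((\<lambda>y. (y, x)) -` S)) \<in> borel_measurable N"
      using YX.measurable_emeasure_Pair2[of S] by (simp add: measure_def)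
    then show ?thesis
      by (rule measurable_cong[THEN iffD1, rotated]) (simp add: g_def sect)
  qed
  have gX[measurable]: "(\<lambda>\<omega>. g (X \<omega>)) \<in> borel_measurable F"
    unfolding F_def using XS by (intro measurable_compose[OF measurable_vimage_algebra1 g])
  have g01: "0 \<le> g x" "g x \<le> 1" for x by (simp_all add: g_def)
  have int_g: "integrable M (\<lambda>\<omega>. g (X \<omega>))"
    using g01 by (intro integrable_const_bound[where B=1]) auto
  have "AE \<omega> in M. real_cond_exp M F (indicator A) \<omega> = g (X \<omega>)"
  proof (rule F.real_cond_exp_charact)
    fix D assume "D \<in> sets F"
    then obtain B where B[measurable]: "B \<in> sets N" and D: "D = X -` B \<inter> space M" by (auto simp: sets_F)
    have D'[measurable]: "D \<in> sets M" unfolding D by measurable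
    have "ennreal (\<integral>\<omega>\<in>D. indicator A \<omega> \<partial>M) = emeasure M (A \<inter> D)"
      by (simp add: set_lebesgue_integral_def emeasure_eq_measure Int_commute
        flip: indicator_inter_arith)
    \<comment> \<open>An event determined by \<open>X\<close> is the preimage of a cylinder over
      \<open>B\<close>, so the section over \<open>x\<close> is all of the section of
      \<open>S\<close> or empty according to whether \<open>x\<close> lies in
      \<open>B\<close>.\<close>
    also have "A \<inter> D = (\<lambda>\<omega>. (Y \<omega>, X \<omega>)) -` (S \<inter> (space K \<times> B)) \<inter> space M"
      using measurable_space[OF Y] by (auto simp: A_eq D)
    also have "emeasure M \<dots> = emeasure (distr M K Y \<Otimes>\<^sub>M distr M N X) (S \<inter> (space K \<times> B))"
      unfolding joint by (subst emeasure_distr) auto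
    also have "\<dots> = (\<integral>\<^sup>+x. emeasure (distr M K Y) ((\<lambda>y. (y, x)) -` (S \<inter> (space K \<times> B))) \<partial>distr M N X)"
      by (intro YX.emeasure_pair_measure_alt2) auto
    also have "\<dots> = (\<integral>\<^sup>+x. ennreal (indicator B x * g x) \<partial>distr M N X)"
    proof (intro nn_integral_cong)
      fix x assume "x \<in> space (distr M N X)"
      then have x: "x \<in> space N" by simp
      have "(\<lambda>y. (y, x)) -` (S \<inter> (space K \<times> B)) = (if x \<in> B then {y \<in> space K. P x y} else {})"
        using sect[OF x] by auto
      then show "emeasure (distr M K Y) ((\<lambda>y. (y, x)) -` (S \<inter> (space K \<times> B))) = ennreal (indicator B x * g x)"
        by (simp add: g_def Y.emeasure_eq_measure)
    qed
    also have "\<dots> = (\<integral>\<^sup>+\<omega>. ennreal (indicator D \<omega> * g (X \<omega>)) \<partial>M)"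
      by (subst nn_integral_distr) (auto simp: D indicator_def intro!: nn_integral_cong)
    also have "\<dots> = ennreal (\<integral>\<omega>\<in>D. g (X \<omega>) \<partial>M)"
      unfolding set_lebesgue_integral_def real_scaleR_def
      using g01 by (intro nn_integral_eq_integral integrable_const_bound[where B=1])
        (auto simp: indicator_def)
    finally show "(\<integral>\<omega>\<in>D. indicator A \<omega> \<partial>M) = (\<integral>\<omega>\<in>D. g (X \<omega>) \<partial>M)"
      using g01 by (subst (asm) ennreal_inj) (auto simp: set_lebesgue_integral_def intro!: integral_nonneg_AE)
  qed (use int_g in \<open>auto intro: integrable_const_bound[where B=1]\<close>)
  then show ?thesis unfolding cond_prob_given_def A_def F_def g_def .
qed

subsection \<open>The shifted quadratic form and its tails\<close>

text \<open>The statistic depends on the matrix only through the vector \<open>M *v x\<close>; as a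
  function of that vector it can also be evaluated off the sphere, at Gaussian vectors.\<close>

definition shift_form :: "nat \<Rightarrow> real^'n::{finite,linorder} \<Rightarrow> real" where
  "shift_form h y = y \<bullet> (matrix_pow shift_matrix h *v y)"

text \<open>For \<open>h \<ge> 1\<close> this is the adjacency matrix of the graph joining positions
  at distance \<open>h\<close>. Symmetrizing counts every edge twice, whence the factor 1/2 in
  \<open>shift_form_eq_weight\<close>.\<close>

definition shift_weight :: "nat \<Rightarrow> 'n::{finite,linorder} \<Rightarrow> 'n \<Rightarrow> real" where
  "shift_weight h i j = of_bool (position j = position i + h) + of_bool (position i = position j + h)"

lemma T_hat_eq_shift_form: "T_hat h x M = shift_form h (M *v x)"
  by (simp add: T_hat_def shift_form_def)

lemma borel_measurable_shift_form [measurable]: "shift_form h \<in> borel_measurable borel"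
  unfolding shift_form_def by measurable

lemma shift_form_scaleR: "shift_form h (c *\<^sub>R y) = c\<^sup>2 * shift_form h y"
  by (simp add: shift_form_def matrix_vector_mult_scaleR power2_eq_square)

lemma shift_form_eq_sum:
  "shift_form h y = (\<Sum>i\<in>UNIV. \<Sum>j\<in>UNIV. of_bool (position j = position i + h) * (y $ i * y $ j))"
  unfolding shift_form_def inner_vec_def matrix_vector_mult_def vec_lambda_beta inner_real_def
    sum_distrib_left matrix_pow_shift
  by (intro sum.cong refl) simp

lemma shift_weight_sym: "shift_weight h i j = shift_weight h j i"
  by (simp add: shift_weight_def)

lemma shift_weight_nonneg: "shift_weight h i j \<ge> 0"
  by (simp add: shift_weight_def)

text \<open>As \<open>position\<close> is injective, there is at most one index at distance
  \<open>h\<close> on either side of \<open>i\<close>.\<close>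

lemma sum_shift_weight_le:
  fixes i :: "'n::{finite,linorder}"
  shows "(\<Sum>j\<in>UNIV. shift_weight h i j) \<le> 2"
proof -
  have inj: "inj (position :: 'n \<Rightarrow> nat)"
    using strict_mono_position by (rule strict_mono_imp_inj_on)
  have le1: "(\<Sum>j\<in>UNIV. of_bool (P j) :: real) \<le> 1" if "\<And>j k. P j \<Longrightarrow> P k \<Longrightarrow> j = k" for P :: "'n \<Rightarrow> bool"
  proof -
    have "card {j. P j} \<le> Suc 0" using that by (intro card_le_Suc0_iff_eq[THEN iffD2]) auto
    then show ?thesis by (simp add: of_bool_def sum.If_cases)
  qed
  have "(\<Sum>j\<in>(UNIV::'n set). of_bool (position j = position i + h) :: real) \<le> 1"
    by (intro le1) (metis inj injD)
  moreover have "(\<Sum>j\<in>(UNIV::'n set). of_bool (position i = position j + h) :: real) \<le> 1"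
    by (intro le1) (metis inj injD add_right_cancel)
  ultimately show ?thesis unfolding shift_weight_def sum.distrib by linarith
qed

lemma shift_form_eq_weight:
  "shift_form h y = (\<Sum>i\<in>UNIV. \<Sum>j\<in>UNIV. shift_weight h i j * y $ i * y $ j) / 2"
proof -
  have "(\<Sum>i\<in>UNIV. \<Sum>j\<in>UNIV. of_bool (position i = position j + h) * (y $ i * y $ j)) = shift_form h y"
    unfolding shift_form_eq_sum by (subst sum.swap) (simp add: mult_ac)
  then have "(\<Sum>i\<in>UNIV. \<Sum>j\<in>UNIV. shift_weight h i j * (y $ i * y $ j)) = 2 * shift_form h y"
    unfolding shift_weight_def distrib_right sum.distrib shift_form_eq_sum[symmetric] by simp
  then show ?thesis by (simp add: mult.assoc)
qed

text \<open>Each product is at most the mean of the two squares; by symmetry of the weights a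
  coordinate then collects its row sum, which is at most 2, and the factor 1/2 absorbs it.\<close>

lemma abs_shift_form_le: "\<bar>shift_form h y\<bar> \<le> (norm y)\<^sup>2"
proof -
  let ?W = "shift_weight h"
  have "\<bar>shift_form h y\<bar> \<le> (\<Sum>i\<in>UNIV. \<Sum>j\<in>UNIV. \<bar>?W i j * y $ i * y $ j\<bar>) / 2"
    unfolding shift_form_eq_weight by (auto intro!: order_trans[OF sum_abs] sum_mono)
  also have "\<dots> \<le> (\<Sum>i\<in>UNIV. \<Sum>j\<in>UNIV. ?W i j * (y $ i)\<^sup>2 / 2 + ?W i j * (y $ j)\<^sup>2 / 2) / 2"
  proof (intro divide_right_mono sum_mono)
    fix i j
    have "\<bar>y $ i * y $ j\<bar> \<le> ((y $ i)\<^sup>2 + (y $ j)\<^sup>2) / 2"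
      using sum_squares_bound[of "\<bar>y $ i\<bar>" "\<bar>y $ j\<bar>"] by (simp add: abs_mult)
    then have "?W i j * \<bar>y $ i * y $ j\<bar> \<le> ?W i j * (((y $ i)\<^sup>2 + (y $ j)\<^sup>2) / 2)"
      by (rule mult_left_mono) (rule shift_weight_nonneg)
    then show "\<bar>?W i j * y $ i * y $ j\<bar> \<le> ?W i j * (y $ i)\<^sup>2 / 2 + ?W i j * (y $ j)\<^sup>2 / 2"
      using shift_weight_nonneg[of h i j] by (simp add: abs_mult field_simps)
  qed simp
  also have "\<dots> = (\<Sum>i\<in>UNIV. \<Sum>j\<in>UNIV. ?W i j * (y $ i)\<^sup>2) / 2"
  proof -
    have "(\<Sum>i\<in>UNIV. \<Sum>j\<in>UNIV. ?W i j * (y $ j)\<^sup>2) = (\<Sum>i\<in>UNIV. \<Sum>j\<in>UNIV. ?W i j * (y $ i)\<^sup>2)"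
      by (subst sum.swap) (simp add: shift_weight_sym[of h _ "_ :: 'a"])
    then show ?thesis by (simp add: sum.distrib sum_divide_distrib[symmetric])
  qed
  also have "\<dots> = (\<Sum>i\<in>UNIV. (\<Sum>j\<in>UNIV. ?W i j) * (y $ i)\<^sup>2) / 2"
    by (simp add: sum_distrib_right)
  also have "\<dots> \<le> (\<Sum>i\<in>UNIV. 2 * (y $ i)\<^sup>2) / 2"
    by (intro divide_right_mono sum_mono mult_right_mono sum_shift_weight_le) auto
  also have "\<dots> = (norm y)\<^sup>2"
    by (simp add: power2_norm_vec sum_distrib_left[symmetric])
  finally show ?thesis .
qed

text \<open>The graph joining positions at distance \<open>h\<close> is a union of paths, hence bipartite.\<close>

definition shift_class :: "nat \<Rightarrow> 'n::{finite,linorder} set" where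
  "shift_class h = {i. even (position i div h)}"

lemma shift_class_bipartite:
  assumes "h \<ge> 1" and "position j = position i + h"
  shows "j \<in> shift_class h \<longleftrightarrow> i \<notin> shift_class h"
proof -
  have "position j div h = Suc (position i div h)" using assms by simp
  then show ?thesis by (simp add: shift_class_def)
qed

lemma shift_weight_bipartite:
  assumes "h \<ge> 1" and "i \<in> shift_class h \<longleftrightarrow> j \<in> shift_class h"
  shows "shift_weight h i j = 0"
  using shift_class_bipartite[OF assms(1), of i j] shift_class_bipartite[OF assms(1), of j i] assms(2)
  by (auto simp: shift_weight_def)

text \<open>Chernoff bound for the quadratic form of a Gaussian vector with density proportional to
  \<open>exp (- (1 - t\<^sup>2 / 2) \<bar>y\<bar>\<^sup>2)\<close>: the variance is chosen so that tilting by
  \<open>exp ((t / 2) (shift_form h y - t \<bar>y\<bar>\<^sup>2))\<close> leaves the weight \<open>exp (- \<bar>y\<bar>\<^sup>2)\<close>.\<close>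

lemma SO_haar_tail:
  fixes x :: "real^'n::{finite,linorder}"
  assumes \<mu>: "normalized_haar SO_group \<mu>" and h: "1 \<le> h" and n: "2 \<le> CARD('n)"
    and x: "norm x = 1" and t: "0 < t" "t \<le> 1"
  shows "measure \<mu> {R \<in> space \<mu>. t \<le> shift_form h (R *v x)} \<le> exp (- (real CARD('n) * t\<^sup>2 / 8))"
proof -
  interpret prob_space \<mu> using \<mu> by (simp add: normalized_haar_def)
  have [measurable]: "(\<lambda>R. R) \<in> borel_measurable \<mu>"
    by (rule normalized_haar_measurable[OF \<mu>]) simp
  \<comment> \<open>Thus \<open>a = 1 - s * t\<close> and \<open>b = 1 - s^2\<close>, and the
    argument yields \<open>p \<le> sqrt (a / b) ^ CARD('n)\<close>. The choice
    \<open>s = t / 2\<close> minimizes \<open>a / b\<close> to leading order in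
    \<open>t\<close>.\<close>
  define a b s where "a = 1 - t\<^sup>2 / 2" and "b = 1 - (t / 2)\<^sup>2" and "s = t / 2"
  have t2: "t\<^sup>2 \<le> 1" using t by (simp add: power_le_one)
  have a: "a > 0" using t2 by (simp add: a_def)
  have b: "b > 0" using t2 by (simp add: b_def power_divide)
  define \<phi> :: "real^'n::{finite,linorder} \<Rightarrow> ennreal" where "\<phi> = indicator {y. t * (norm y)\<^sup>2 \<le> shift_form h y}"
  have \<phi>[measurable]: "\<phi> \<in> borel_measurable borel" unfolding \<phi>_def by measurable
  have hom: "\<phi> (c *\<^sub>R y) = \<phi> y" if "c > 0" for c y
    using that by (simp add: \<phi>_def indicator_def shift_form_scaleR power_mult_distrib mult.left_commute)
  define p where "p = measure \<mu> {R \<in> space \<mu>. t \<le> shift_form h (R *v x)}"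
  have Rx: "norm (R *v x) = 1" if "R \<in> space \<mu>" for R
    using that x by (simp add: normalized_haar_space[OF \<mu>] SO_group_def rotation_matrix_def orthogonal_matrix_norm)
  have A: "{R \<in> space \<mu>. t \<le> shift_form h (R *v x)} \<in> sets \<mu>" by measurable
  have "ennreal p = (\<integral>\<^sup>+R. indicator {R \<in> space \<mu>. t \<le> shift_form h (R *v x)} R \<partial>\<mu>)"
    unfolding p_def emeasure_eq_measure[symmetric] using A by simp
  also have "\<dots> = (\<integral>\<^sup>+R. \<phi> (R *v x) \<partial>\<mu>)"
    by (intro nn_integral_cong) (simp add: \<phi>_def indicator_def Rx)
  finally have "ennreal (p * sqrt (pi / a) ^ CARD('n)) =
      (\<integral>\<^sup>+R. \<phi> (R *v x) \<partial>\<mu>) * (\<integral>\<^sup>+y. ennreal (exp (- (a * (norm (y :: real^'n::{finite,linorder}))\<^sup>2))) \<partial>lborel)"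
    using a by (simp add: nn_integral_exp_minus_norm_square ennreal_mult p_def)
  also have "\<dots> = (\<integral>\<^sup>+y. \<phi> y * ennreal (exp (- (a * (norm (y :: real^'n::{finite,linorder}))\<^sup>2))) \<partial>lborel)"
    by (intro SO_haar_average_radial[OF \<mu> n x \<phi> hom, symmetric]) auto
  also have "\<dots> \<le> (\<integral>\<^sup>+y. exp (s * shift_form h y - (norm (y :: real^'n::{finite,linorder}))\<^sup>2) \<partial>lborel)"
  proof (intro nn_integral_mono)
    fix y :: "real^'n::{finite,linorder}"
    have "- (a * (norm y)\<^sup>2) \<le> s * shift_form h y - (norm y)\<^sup>2" if "t * (norm y)\<^sup>2 \<le> shift_form h y"
      using mult_left_mono[OF that, of s] t by (simp add: a_def s_def algebra_simps power2_eq_square)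
    then show "\<phi> y * ennreal (exp (- (a * (norm y)\<^sup>2))) \<le> ennreal (exp (s * shift_form h y - (norm y)\<^sup>2))"
      by (auto simp: \<phi>_def indicator_def intro!: ennreal_leI)
  qed
  also have "\<dots> \<le> ennreal (sqrt (pi / b) ^ CARD('n))"
    unfolding shift_form_eq_weight b_def s_def using t2 h
    by (intro nn_integral_exp_bipartite_form_le[where B="shift_class h"] sum_shift_weight_le shift_weight_nonneg)
       (auto simp: shift_weight_sym shift_weight_bipartite power_divide)
  finally have "p * sqrt (pi / a) ^ CARD('n) \<le> sqrt (pi / b) ^ CARD('n)"
    using b by (subst (asm) ennreal_le_iff) auto
  then have "p \<le> sqrt (pi / b) ^ CARD('n) / sqrt (pi / a) ^ CARD('n)"
    using a by (subst pos_le_divide_eq) auto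
  also have "\<dots> = sqrt (a / b) ^ CARD('n)"
    using a b by (simp add: power_divide[symmetric] real_sqrt_divide[symmetric])
  also have "\<dots> \<le> sqrt (exp (- (t\<^sup>2 / 4))) ^ CARD('n)"
  proof (intro power_mono real_sqrt_le_mono)
    \<comment> \<open>Since \<open>b = 1 - t^2 / 4\<close>, the right-hand side is a square and
      exceeds \<open>a\<close> by exactly \<open>t^4 / 16\<close>.\<close>
    have "a \<le> (1 - t\<^sup>2 / 4) * b"
      by (simp add: a_def b_def power_divide algebra_simps)
    then have "a / b \<le> 1 - t\<^sup>2 / 4" using b by (simp add: pos_divide_le_eq)
    also have "\<dots> \<le> exp (- (t\<^sup>2 / 4))" using exp_ge_add_one_self[of "- (t\<^sup>2 / 4)"] by simp
    finally show "a / b \<le> exp (- (t\<^sup>2 / 4))" .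
  qed (use a b in simp)
  also have "sqrt (exp (- (t\<^sup>2 / 4))) = exp (- (t\<^sup>2 / 8))"
    by (rule real_sqrt_unique) (simp_all add: exp_double[symmetric] flip: exp_of_nat_mult)
  also have "exp (- (t\<^sup>2 / 8)) ^ CARD('n) = exp (- (real CARD('n) * t\<^sup>2 / 8))"
    by (simp add: exp_of_nat_mult[symmetric])
  finally show ?thesis unfolding p_def .
qed

section \<open>Tails and expectations for the two finite groups\<close>

lemma (in prob_space) tail_of_nonpos_expectation:
  fixes f :: "'a \<Rightarrow> real"
  assumes f[measurable]: "f \<in> borel_measurable M" and bound: "\<And>\<omega>. \<omega> \<in> space M \<Longrightarrow> \<bar>f \<omega>\<bar> \<le> 1"
    and E: "expectation f \<le> 0" and t: "0 < t" "t \<le> 1"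
  shows "prob {\<omega> \<in> space M. t \<le> f \<omega>} \<le> exp (- (t\<^sup>2 / 16))"
proof -
  define A where "A = {\<omega> \<in> space M. t \<le> f \<omega>}"
  have [measurable]: "A \<in> events" unfolding A_def by measurable
  have int_A: "integrable M (indicat_real A)"
    by (intro integrable_const_bound[where B=1]) auto
  \<comment> \<open>The integrand is \<open>t\<close> on \<open>A\<close> and \<open>-1\<close> off
    \<open>A\<close>, the least values that \<open>f\<close> can take there.\<close>
  then have "(1 + t) * prob A - 1 = expectation (\<lambda>\<omega>. (1 + t) * indicator A \<omega> - 1)"
    by (subst Bochner_Integration.integral_diff) (auto simp: prob_space)
  also have "\<dots> \<le> expectation f"
  proof (intro integral_mono)
    show "integrable M f" using bound by (intro integrable_const_bound[where B=1]) auto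
    fix \<omega> assume "\<omega> \<in> space M"
    then show "(1 + t) * indicator A \<omega> - 1 \<le> f \<omega>"
      using bound[of \<omega>] by (auto simp: A_def indicator_def)
  qed (use int_A in auto)
  finally have "(1 + t) * prob A \<le> 1" using E by simp
  also have "\<dots> \<le> (1 + t) * (1 - t\<^sup>2 / 16)"
  proof -
    \<comment> \<open>This is 16 times the amount by which \<open>(1 + t) * (1 - t / 16)\<close>
      exceeds 1; afterwards \<open>t^2 \<le> t\<close> replaces \<open>t\<close> by its
      square.\<close>
    have "0 \<le> t * (15 - t)" using t by simp
    then have "1 \<le> (1 + t) * (1 - t / 16)" by (simp add: field_simps)
    also have "\<dots> \<le> (1 + t) * (1 - t\<^sup>2 / 16)"
      using t power_decreasing[of 1 2 t] by (intro mult_left_mono) auto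
    finally show ?thesis by simp
  qed
  finally have "prob A \<le> 1 - t\<^sup>2 / 16" using t by (simp add: mult_le_cancel_left)
  also have "\<dots> \<le> exp (- (t\<^sup>2 / 16))" using exp_ge_add_one_self[of "- (t\<^sup>2 / 16)"] by simp
  finally show ?thesis unfolding A_def .
qed

lemma sign_group_mult: "A \<in> sign_group \<Longrightarrow> B \<in> sign_group \<Longrightarrow> A ** B \<in> sign_group"
proof -
  assume "A \<in> sign_group" "B \<in> sign_group"
  then obtain \<epsilon> \<delta> where A: "A = sign_matrix \<epsilon>" "\<forall>i. \<epsilon> i \<in> {-1, 1}" and B: "B = sign_matrix \<delta>" "\<forall>i. \<delta> i \<in> {-1, 1}"
    by (auto simp: sign_group_def)
  have "A ** B = sign_matrix (\<lambda>i. \<epsilon> i * \<delta> i)"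
    unfolding matrix_eq A B
    by (simp add: vec_eq_iff matrix_vector_mul_assoc[symmetric] sign_matrix_mult_vec)
  moreover have "\<epsilon> i * \<delta> i \<in> {-1, 1}" for i
    using A(2)[rule_format, of i] B(2)[rule_format, of i] by auto
  ultimately show "A ** B \<in> sign_group" unfolding sign_group_def by blast
qed

lemma perm_group_mult: "A \<in> perm_group \<Longrightarrow> B \<in> perm_group \<Longrightarrow> A ** B \<in> perm_group"
proof -
  assume "A \<in> perm_group" "B \<in> perm_group"
  then obtain p q where A: "A = perm_matrix p" "p permutes UNIV" and B: "B = perm_matrix q" "q permutes UNIV"
    by (auto simp: perm_group_def)
  \<comment> \<open>Permutation matrices act by precomposing the index, which reverses the order of
    composition.\<close>
  have "A ** B = perm_matrix (q \<circ> p)"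
    unfolding matrix_eq A B
    by (simp add: vec_eq_iff matrix_vector_mul_assoc[symmetric] perm_matrix_mult_vec)
  then show "A ** B \<in> perm_group"
    unfolding perm_group_def using permutes_compose[OF A(2) B(2)] by blast
qed

lemma sign_group_norm: "A \<in> sign_group \<Longrightarrow> norm (A *v x) = norm x"
  by (auto simp: sign_group_def sign_matrix_mult_vec norm_vec_def L2_set_def power_mult_distrib
      intro!: sum.cong) (metis mult_1 power2_minus power_one)

lemma sum_perm_matrix:
  assumes "p permutes UNIV"
  shows "(\<Sum>i\<in>UNIV. f ((perm_matrix p *v x) $ i)) = (\<Sum>i\<in>UNIV. f (x $ i))"
  using sum.permute[OF assms, of "\<lambda>i. f (x $ i)"] by (simp add: perm_matrix_mult_vec comp_def)

lemma perm_group_norm: "A \<in> perm_group \<Longrightarrow> norm (A *v x) = norm x"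
  by (auto simp: perm_group_def norm_vec_def L2_set_def sum_perm_matrix[of _ "\<lambda>x. x\<^sup>2"])

text \<open>Flipping all signs on one class of the bipartition turns the quadratic form into its negative.\<close>

lemma sign_haar_expectation:
  fixes x :: "real^'n::{finite,linorder}"
  assumes \<mu>: "normalized_haar sign_group \<mu>" and h: "1 \<le> h"
  shows "(\<integral>R. shift_form h (R *v x) \<partial>\<mu>) = 0"
proof -
  define \<epsilon> :: "'n \<Rightarrow> real" where "\<epsilon> i = (if i \<in> shift_class h then -1 else 1)" for i
  have g: "sign_matrix \<epsilon> \<in> sign_group"
  proof -
    have "\<forall>i. \<epsilon> i \<in> {-1, 1}" by (simp add: \<epsilon>_def)
    then show ?thesis unfolding sign_group_def by blast
  qed
  have flip: "shift_form h (sign_matrix \<epsilon> *v y) = - shift_form h y" for y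
    unfolding shift_form_eq_sum sum_negf[symmetric] using shift_class_bipartite[OF h]
    by (intro sum.cong refl) (auto simp: sign_matrix_mult_vec \<epsilon>_def)
  have "(\<integral>R. shift_form h (R *v x) \<partial>\<mu>) = (\<integral>R. shift_form h ((sign_matrix \<epsilon> ** R) *v x) \<partial>\<mu>)"
    using g by (intro normalized_haar_integral_translate[OF \<mu>, of _ "\<lambda>R. shift_form h (R *v x)", symmetric])
      (auto intro: sign_group_mult)
  also have "\<dots> = - (\<integral>R. shift_form h (R *v x) \<partial>\<mu>)"
    by (simp add: matrix_vector_mul_assoc[symmetric] flip)
  finally show ?thesis by simp
qed

text \<open>For fixed \<open>i\<close>, invariance makes all mixed moments \<open>c i k\<close> with
  \<open>k \<noteq> i\<close> equal. Because the coordinates sum to zero, these moments add up to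
  minus the second moment of coordinate \<open>i\<close>, so each of them is nonpositive.\<close>

lemma perm_haar_expectation:
  fixes x :: "real^'n::{finite,linorder}"
  assumes \<mu>: "normalized_haar perm_group \<mu>" and h: "1 \<le> h"
    and x: "(\<Sum>i\<in>UNIV. x $ i) = 0"
  shows "(\<integral>R. shift_form h (R *v x) \<partial>\<mu>) \<le> 0"
proof -
  interpret prob_space \<mu> using \<mu> by (simp add: normalized_haar_def)
  note sp = normalized_haar_space[OF \<mu>]
  have [measurable]: "(\<lambda>R. R) \<in> borel_measurable \<mu>"
    by (rule normalized_haar_measurable[OF \<mu>]) simp
  have nth[measurable]: "(\<lambda>y :: real^'n::{finite,linorder}. y $ i) \<in> borel_measurable borel" for i
    by (intro borel_measurable_continuous_onI continuous_intros)
  define c where "c i j = (\<integral>R. (R *v x) $ i * (R *v x) $ j \<partial>\<mu>)" for i j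
  have int: "integrable \<mu> (\<lambda>R. (R *v x) $ i * (R *v x) $ j)" for i j
  proof (rule integrable_const_bound[where B="norm x * norm x"])
    show "AE R in \<mu>. norm ((R *v x) $ i * (R *v x) $ j) \<le> norm x * norm x"
    proof (rule AE_I2)
      fix R assume "R \<in> space \<mu>"
      then have "norm (R *v x) = norm x" by (simp add: sp perm_group_norm)
      then have "norm ((R *v x) $ k) \<le> norm x" for k using Finite_Cartesian_Product.norm_nth_le[of "R *v x" k] by simp
      then show "norm ((R *v x) $ i * (R *v x) $ j) \<le> norm x * norm x"
        unfolding norm_mult by (intro mult_mono) auto
    qed
  qed measurable
  have swap: "c i j = c i k" if "i \<noteq> j" "i \<noteq> k" for i j k
  proof -
    \<comment> \<open>The transposition of \<open>j\<close> and \<open>k\<close> leaves coordinate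
      \<open>i\<close> in place because \<open>i\<close> differs from both.\<close>
    let ?g = "perm_matrix (Transposition.transpose j k) :: real^'n::{finite,linorder}^'n::{finite,linorder}"
    have g: "?g \<in> perm_group"
      unfolding perm_group_def using permutes_swap_id[of j UNIV k] by blast
    have "c i j = (\<integral>R. ((?g ** R) *v x) $ i * ((?g ** R) *v x) $ j \<partial>\<mu>)"
      unfolding c_def using g
      by (intro normalized_haar_integral_translate[OF \<mu>, of _ "\<lambda>R. (R *v x) $ i * (R *v x) $ j", symmetric])
        (auto intro: perm_group_mult)
    also have "\<dots> = c i k"
      using that by (simp add: c_def matrix_vector_mul_assoc[symmetric] perm_matrix_mult_vec)
    finally show ?thesis .
  qed
  have c_le: "c i j \<le> 0" if ij: "i \<noteq> j" for i j
  proof -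
    have "real (card (UNIV - {i})) * c i j = (\<Sum>k\<in>UNIV - {i}. c i k)"
    proof -
      have "(\<Sum>k\<in>UNIV - {i}. c i k) = (\<Sum>k\<in>UNIV - {i}. c i j)"
        using ij by (intro sum.cong refl swap) auto
      then show ?thesis by simp
    qed
    also have "\<dots> = (\<integral>R. (\<Sum>k\<in>UNIV - {i}. (R *v x) $ i * (R *v x) $ k) \<partial>\<mu>)"
      unfolding c_def using int by (subst Bochner_Integration.integral_sum) auto
    also have "\<dots> = (\<integral>R. - ((R *v x) $ i)\<^sup>2 \<partial>\<mu>)"
    proof (intro Bochner_Integration.integral_cong refl)
      fix R assume "R \<in> space \<mu>"
      then obtain p where p: "R = perm_matrix p" "p permutes UNIV" by (auto simp: sp perm_group_def)
      have "(\<Sum>k\<in>UNIV. (R *v x) $ k) = 0"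
        using sum_perm_matrix[OF p(2), of "\<lambda>x. x" x] x by (simp add: p)
      then have "(\<Sum>k\<in>UNIV - {i}. (R *v x) $ k) = - (R *v x) $ i"
        by (simp add: sum_diff1)
      then show "(\<Sum>k\<in>UNIV - {i}. (R *v x) $ i * (R *v x) $ k) = - ((R *v x) $ i)\<^sup>2"
        by (simp add: sum_distrib_left[symmetric] power2_eq_square)
    qed
    also have "\<dots> \<le> 0" by simp
    \<comment> \<open>The index \<open>j\<close> belongs to \<open>UNIV - {i}\<close>, so the
      cardinality is positive and can be divided out.\<close>
    finally show ?thesis
      using ij card_gt_0_iff[of "UNIV - {i}"] by (auto simp: mult_le_0_iff)
  qed
  have "(\<integral>R. shift_form h (R *v x) \<partial>\<mu>)
      = (\<Sum>i\<in>UNIV. \<Sum>j\<in>UNIV. of_bool (position j = position i + h) * c i j)"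
    unfolding shift_form_eq_sum c_def using int by (simp add: Bochner_Integration.integral_sum)
  also have "\<dots> \<le> 0"
  proof -
    \<comment> \<open>A positive shift keeps the form off the diagonal, where the moments are
      nonnegative.\<close>
    have "c i j \<le> 0" if "position j = position i + h" for i j
      using that h by (intro c_le) auto
    then show ?thesis by (intro sum_nonpos) auto
  qed
  finally show ?thesis .
qed

section \<open>The tail bounds for all three groups and the conditional statement\<close>

lemma haar_tail:
  fixes x :: "real^'n::{finite,linorder}"
  assumes \<mu>: "normalized_haar G \<mu>" and G: "G \<in> {SO_group, perm_group, sign_group}"
    and h: "1 \<le> h" and n: "2 \<le> CARD('n)" and x: "norm x = 1"
    and sum: "G = perm_group \<Longrightarrow> (\<Sum>i\<in>UNIV. x $ i) = 0" and t: "t > 0"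
  shows "measure \<mu> {R \<in> space \<mu>. t \<le> T_hat h x R} \<le>
    (if G = SO_group then exp (- ((real CARD('n) - 2) * t\<^sup>2 / 64))
     else if G = perm_group then exp (- (t\<^sup>2 / 16))
     else exp (- (t\<^sup>2 / 64)))"
proof -
  interpret prob_space \<mu> using \<mu> by (simp add: normalized_haar_def)
  have [measurable]: "(\<lambda>R. R) \<in> borel_measurable \<mu>"
    by (rule normalized_haar_measurable[OF \<mu>]) simp
  have bound: "\<bar>shift_form h (R *v x)\<bar> \<le> 1" if "R \<in> space \<mu>" for R
  proof -
    have "R \<in> G" using that by (simp add: normalized_haar_space[OF \<mu>])
    then have "norm (R *v x) = norm x"
      using G by (auto simp: SO_group_def rotation_matrix_def orthogonal_matrix_norm perm_group_norm sign_group_norm)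
    then show ?thesis using abs_shift_form_le[of h "R *v x"] x by simp
  qed
  show ?thesis
  proof (cases "t \<le> 1")
    case False
    \<comment> \<open>All three groups preserve norms, so the statistic never exceeds 1.\<close>
    then have "{R \<in> space \<mu>. t \<le> T_hat h x R} = {}"
      using bound by (force simp: T_hat_eq_shift_form)
    then show ?thesis by (simp only: measure_empty) simp
  next
    case True
    have small: "prob {R \<in> space \<mu>. t \<le> T_hat h x R} \<le> exp (- (t\<^sup>2 / 16))"
      if "(\<integral>R. shift_form h (R *v x) \<partial>\<mu>) \<le> 0"
      unfolding T_hat_eq_shift_form using t True bound that
      by (intro tail_of_nonpos_expectation) auto
    have weaken: "exp (- (t\<^sup>2 / 16)) \<le> exp (- (t\<^sup>2 / 64))" by simp
    consider "G = SO_group" | "G \<noteq> SO_group" "G = perm_group" | "G \<noteq> SO_group" "G \<noteq> perm_group" "G = sign_group"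
      using G by auto
    then show ?thesis
    proof cases
      case 1
      \<comment> \<open>The Gaussian comparison gives a faster rate than the stated one, which
        follows by weakening.\<close>
      have "(real CARD('n) - 2) * t\<^sup>2 / 64 \<le> real CARD('n) * t\<^sup>2 / 8"
        by (simp add: field_simps)
      then have "exp (- (real CARD('n) * t\<^sup>2 / 8)) \<le> exp (- ((real CARD('n) - 2) * t\<^sup>2 / 64))"
        by simp
      moreover have "prob {R \<in> space \<mu>. t \<le> T_hat h x R} \<le> exp (- (real CARD('n) * t\<^sup>2 / 8))"
        unfolding T_hat_eq_shift_form using \<mu> 1 h n x t True by (intro SO_haar_tail) auto
      ultimately show ?thesis unfolding if_P[OF 1] by (rule order_trans[rotated])
    next
      case 2
      with small[OF perm_haar_expectation[of \<mu> h x]] \<mu> h sum show ?thesis by simp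
    next
      case 3
      then have "prob {R \<in> space \<mu>. t \<le> T_hat h x R} \<le> exp (- (t\<^sup>2 / 16))"
        using small sign_haar_expectation[of \<mu> h x] \<mu> h by simp
      also note weaken
      finally show ?thesis using 3 by simp
    qed
  qed
qed

theorem theorem3p1:
  fixes \<Omega> :: "'a measure"
    and h :: nat
    and X :: "'a \<Rightarrow> real^'n::{finite,linorder}"
    and G :: "(real^'n::{finite,linorder}^'n::{finite,linorder}) set"
    and M :: "'a \<Rightarrow> real^'n::{finite,linorder}^'n::{finite,linorder}"
    and t :: real
  assumes "prob_space \<Omega>"
    and "1 \<le> h" and "h < CARD('n)"
    and "X \<in> measurable \<Omega> (restrict_space borel (sphere 0 1))"
    and "G \<in> {SO_group, perm_group, sign_group}"
    and "G = perm_group \<Longrightarrow> AE \<omega> in \<Omega>. (\<Sum>i\<in>UNIV. X \<omega> $ i) = 0"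
    and "M \<in> measurable \<Omega> (restrict_space borel G)"
    and "prob_space.indep_set \<Omega>
          (sets (vimage_algebra (space \<Omega>) M (restrict_space borel G)))
          (sets (vimage_algebra (space \<Omega>) X (restrict_space borel (sphere 0 1))))"
    and "normalized_haar G (distr \<Omega> (restrict_space borel G) M)"
    and "t > 0"
  shows "AE \<omega> in \<Omega>.
    cond_prob_given \<Omega> (restrict_space borel (sphere 0 1)) X (\<lambda>\<omega>'. T_hat h (X \<omega>') (M \<omega>') \<ge> t) \<omega>
      \<le> (if G = SO_group then exp (- ((real CARD('n) - 2) * t\<^sup>2 / 64))
         else if G = perm_group then exp (- (t\<^sup>2 / 16))
         else exp (- (t\<^sup>2 / 64)))"
proof -
  interpret prob_space \<Omega> by fact
  let ?K = "restrict_space borel G" and ?N = "restrict_space borel (sphere 0 1) :: (real^'n::{finite,linorder}) measure"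
  let ?\<mu> = "distr \<Omega> ?K M"
  have id: "(\<lambda>R. R) \<in> borel_measurable ?K" "(\<lambda>x. x) \<in> borel_measurable ?N"
    by (simp_all add: measurable_restrict_space1)
  \<comment> \<open>The factors carry trace sigma-algebras; composing the projections with the
    inclusions into the ambient spaces makes the Borel measurability rules applicable.\<close>
  have [measurable]: "fst \<in> borel_measurable (?K \<Otimes>\<^sub>M ?N)" "snd \<in> borel_measurable (?K \<Otimes>\<^sub>M ?N)"
    using measurable_compose[OF measurable_fst id(1), of ?N] measurable_compose[OF measurable_snd id(2), of ?K]
    by (auto simp: comp_def)
  have "{p \<in> space (?K \<Otimes>\<^sub>M ?N). t \<le> T_hat h (snd p) (fst p)} \<in> sets (?K \<Otimes>\<^sub>M ?N)"
    unfolding T_hat_eq_shift_form by measurable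
  from cond_prob_given_indep[OF assms(4,7,8) this]
  have cond: "AE \<omega> in \<Omega>. cond_prob_given \<Omega> ?N X (\<lambda>\<omega>'. t \<le> T_hat h (X \<omega>') (M \<omega>')) \<omega> =
      measure ?\<mu> {R \<in> space ?K. t \<le> T_hat h (X \<omega>) R}" .
  \<comment> \<open>The zero-sum condition holds only almost surely and for one group; moving the
    case distinction inside the quantifier lets it be combined pointwise with
    \<open>cond\<close>.\<close>
  have sum: "AE \<omega> in \<Omega>. G = perm_group \<longrightarrow> (\<Sum>i\<in>UNIV. X \<omega> $ i) = 0"
    using assms(6) by (cases "G = perm_group") auto
  from cond sum AE_space show ?thesis
  proof eventually_elim
    case (elim \<omega>)
    have "X \<omega> \<in> space ?N" using assms(4) elim(3) by (rule measurable_space)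
    then have "norm (X \<omega>) = 1" by (simp add: space_restrict_space)
    then show ?case
      using haar_tail[OF assms(9,5,2), of "X \<omega>" t] assms(2,3,10) elim by simp
  qed
qed

end
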